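(* Let $E\to M$ be a vector bundle, $n$ an integer with $1<n<\dim M+1$, and $\mathcal{E}=\mathfrak{D}E\oplus\mathfrak{J}_nE$ the higher omni-Lie algebroid of $E$. Let $L\subset\mathcal{E}$ be an isotropic subbundle projecting isomorphically onto $\mathfrak{J}_nE$. Then $L=0\oplus\mathfrak{J}_nE$, and, in this case, $L$ is necessarily a higher Dirac-Jacobi structure.
   Context: Let $E\to M$ be a (smooth, real) vector bundle. A derivation of $E$ is an $\mathbb{R}$-linear operator $\mathfrak{d}:\Gamma(E)\to\Gamma(E)$ with $\mathfrak{d}(fu)=\sigma(\mathfrak{d})(f)\,u+f\,\mathfrak{d}u$ for all $f\in C^\infty(M)$, $u\in\Gamma(E)$, for some (unique) vector field $\sigma(\mathfrak{d})$, its symbol. Derivations are the sections of a vector bundle $\mathfrak{D}E\to M$, a Lie algebroid (the gauge algebroid) with bracket the commutator $[-,-]_{\mathfrak{D}}$ and surjective anchor $\sigma:\mathfrak{D}E\to TM$, whose kernel is $\mathfrak{gl}(E)$, the bundle of endomorphisms of $E$. Let $\Omega^k(\mathfrak{D}E,E)=\Gamma(\operatorname{Hom}(\wedge^k\mathfrak{D}E,E))$, with differential $$d_{\mathfrak D}\mu(\mathfrak{d}_0,\dots,\mathfrak{d}_k)=\sum_i(-1)^i\mathfrak{d}_i\big(\mu(\mathfrak{d}_0,\dots,\widehat{\mathfrak{d}_i},\dots,\mathfrak{d}_k)\big)+\sum_{i<j}(-1)^{i+j}\mu([\mathfrak{d}_i,\mathfrak{d}_j]_{\mathfrak D},\dots,\widehat{\mathfrak{d}_i},\dots,\widehat{\mathfrak{d}_j},\dots,\mathfrak{d}_k).$$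 $\iota_{\mathfrak d}$ is contraction (insertion in the first slot) and $\mathcal{L}_{\mathfrak d}=\iota_{\mathfrak d}d_{\mathfrak D}+d_{\mathfrak D}\iota_{\mathfrak d}$ is the Lie derivative. For $\lambda\in\operatorname{Hom}(\wedge^kTM,E)$ put $\sigma^*\lambda=\lambda(\sigma-,\dots,\sigma-)$. $\mathfrak{J}_kE\subset\operatorname{Hom}(\wedge^k\mathfrak{D}E,E)$ is the subbundle of those $\mu$ for which there is $\lambda_\mu\in\operatorname{Hom}(\wedge^{k-1}TM,E)$ with $\iota_\Phi\mu=\Phi\circ\sigma^*\lambda_\mu$ for all $\Phi\in\mathfrak{gl}(E)$ (so $\mathfrak{J}_0E=E$). The spaces $\Gamma(\mathfrak{J}_kE)$ are preserved by $d_{\mathfrak D}$, $\iota_{\mathfrak d}$ and $\mathcal{L}_{\mathfrak d}$. For a positive integer $n$, the higher omni-Lie algebroid is $\mathcal{E}=\mathfrak{D}E\oplus\mathfrak{J}_nE$ with the bracket on sections $$\{\mathfrak{d}+\mu,\mathfrak{r}+\nu\}=[\mathfrak{d},\mathfrak{r}]_{\mathfrak D}+\mathcal{L}_{\mathfrak d}\nu-\iota_{\mathfrak r}d_{\mathfrak D}\mu$$ and the $\mathfrak{J}_{n-1}E$-valued symmetric bilinear pairing $(\mathfrak{d}+\mu,\mathfrak{r}+\nu)_+=\tfrac12(\iota_{\mathfrak d}\nu+\iota_{\mathfrak r}\mu)$. A subbundle $L\subset\mathcal{E}$ is isotropic if $(e_1,e_2)_+=0$ for all $e_1,e_2\in L$;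 involutive if $\{e_1,e_2\}\in\Gamma(L)$ for all $e_1,e_2\in\Gamma(L)$. A maximal isotropic (with respect to inclusion among isotropic subbundles) and involutive subbundle is a higher Dirac-Jacobi structure. "Projecting isomorphically onto $\mathfrak{J}_nE$" means that the restriction to $L$ of the projection $\mathcal{E}\to\mathfrak{J}_nE$ is a vector bundle isomorphism.
   Formalization: The case where E is a line bundle and n = dim M is excluded: there the claim fails, since e.g. the graph of a nowhere vanishing section of Hom(∧^{n+1}DE, E) is isotropic and projects isomorphically onto J_nE without being 0⊕J_nE. *)

theory Defs
  imports "HOL-Analysis.Analysis" "HOL-Library.Function_Algebras"
begin

instantiation "fun" :: (type, scaleR) scaleR
begin
definition scaleR_fun :: "real \<Rightarrow> ('a \<Rightarrow> 'b) \<Rightarrow> 'a \<Rightarrow> 'b"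
  where "scaleR_fun c f = (\<lambda>x. c *\<^sub>R f x)"
instance ..
end

instance "fun" :: (type, real_vector) real_vector
  by standard (auto simp: scaleR_fun_def fun_eq_iff scaleR_add_right scaleR_add_left)


section \<open>Smooth manifolds\<close>

primrec times_differentiable_on ::
  "nat \<Rightarrow> 'a::real_normed_vector set \<Rightarrow> ('a \<Rightarrow> 'b::real_normed_vector) \<Rightarrow> bool" where
  "times_differentiable_on 0 S f \<longleftrightarrow> continuous_on S f"
| "times_differentiable_on (Suc k) S f \<longleftrightarrow>
     (\<forall>x\<in>S. f differentiable (at x)) \<and>
     (\<forall>v. times_differentiable_on k S (\<lambda>x. frechet_derivative f (at x) v))"

text \<open>Only meant for open \<open>S\<close>.\<close>
definition smooth_on ::
  "'a::real_normed_vector set \<Rightarrow> ('a \<Rightarrow> 'b::real_normed_vector) \<Rightarrow> bool" where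
  "smooth_on S f \<longleftrightarrow> (\<forall>k. times_differentiable_on k S f)"

text \<open>The manifold is the whole type \<open>'p\<close>; \<open>'m\<close> is the model space, so that
  \<open>DIM('m)\<close> is the dimension of the manifold. Any atlas of the smooth structure will do, it
  need not be maximal.\<close>
definition smooth_manifold ::
  "('p::{t2_space,second_countable_topology} set \<times> ('p \<Rightarrow> 'm::euclidean_space)) set \<Rightarrow> bool" where
  "smooth_manifold A \<longleftrightarrow>
     (\<forall>(U, \<phi>)\<in>A. open U \<and> open (\<phi> ` U) \<and> homeomorphism U (\<phi> ` U) \<phi> (inv_into U \<phi>)) \<and>
     (\<Union>(U, \<phi>)\<in>A. U) = UNIV \<and>
     (\<forall>(U, \<phi>)\<in>A. \<forall>(V, \<psi>)\<in>A. smooth_on (\<phi> ` (U \<inter> V)) (\<psi> \<circ> inv_into U \<phi>))"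

text \<open>Smoothness on an open set \<open>W\<close> of a map from the manifold into a Euclidean space.\<close>
definition smooth_map_on ::
  "('p::topological_space set \<times> ('p \<Rightarrow> 'm::euclidean_space)) set \<Rightarrow> 'p set
     \<Rightarrow> ('p \<Rightarrow> 'b::euclidean_space) \<Rightarrow> bool" where
  "smooth_map_on A W f \<longleftrightarrow> (\<forall>(U, \<phi>)\<in>A. smooth_on (\<phi> ` (U \<inter> W)) (f \<circ> inv_into U \<phi>))"

definition smooth_functions ::
  "('p::topological_space set \<times> ('p \<Rightarrow> 'm::euclidean_space)) set \<Rightarrow> ('p \<Rightarrow> real) set" where
  "smooth_functions A = {f. smooth_map_on A UNIV f}"

text \<open>Tangent vectors at \<open>x\<close> are the \<open>\<real>\<close>-linear point derivations of the algebra of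
  smooth functions. Being functions on all of \<open>'p \<Rightarrow> real\<close>, they are extended by zero to
  non-smooth arguments; the same convention is used for all spaces of maps below.\<close>
definition tangent_space ::
  "('p::topological_space set \<times> ('p \<Rightarrow> 'm::euclidean_space)) set \<Rightarrow> 'p
     \<Rightarrow> (('p \<Rightarrow> real) \<Rightarrow> real) set" where
  "tangent_space A x = {v.
     (\<forall>f\<in>smooth_functions A. \<forall>g\<in>smooth_functions A.
        v (f + g) = v f + v g \<and> v (f * g) = v f * g x + f x * v g) \<and>
     (\<forall>f\<in>smooth_functions A. \<forall>c. v (c *\<^sub>R f) = c * v f) \<and>
     (\<forall>f. f \<notin> smooth_functions A \<longrightarrow> v f = 0)}"

definition vector_fields ::
  "('p::topological_space set \<times> ('p \<Rightarrow> 'm::euclidean_space)) set \<Rightarrow> 'p set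
     \<Rightarrow> ('p \<Rightarrow> ('p \<Rightarrow> real) \<Rightarrow> real) set" where
  "vector_fields A W = {X. (\<forall>x\<in>W. X x \<in> tangent_space A x) \<and>
     (\<forall>f\<in>smooth_functions A. smooth_map_on A W (\<lambda>x. X x f))}"


section \<open>Vector bundles\<close>

text \<open>The fibres are subspaces of some real vector space \<open>'e\<close>. This space is only an ambient
  set carrying the linear structure of the individual fibres: it has no topology, it is unrelated
  to the smooth structure, and fibres over different points may overlap. Every family of vector
  spaces has such a form (embed the fibres in their direct sum), so this is no restriction.
  The smooth structure is given by the local trivialisations \<open>(U, \<psi>)\<close>, where \<open>\<psi> x\<close> identifies
  the fibre at \<open>x \<in> U\<close> with the typical fibre \<open>'f\<close>. That \<open>\<psi> x\<close> is linear on the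
  whole of \<open>'e\<close> is no restriction either, since linear maps extend from subspaces.\<close>
record ('p, 'm, 'e, 'f) vbundle =
  atlas :: "('p set \<times> ('p \<Rightarrow> 'm)) set"
  fibre :: "'p \<Rightarrow> 'e set"
  trivs :: "('p set \<times> ('p \<Rightarrow> 'e \<Rightarrow> 'f)) set"

definition vector_bundle ::
  "('p::{t2_space,second_countable_topology}, 'm::euclidean_space, 'e::real_vector,
     'f::euclidean_space) vbundle \<Rightarrow> bool" where
  "vector_bundle E \<longleftrightarrow>
     smooth_manifold (atlas E) \<and>
     (\<forall>x. subspace (fibre E x)) \<and>
     (\<forall>(U, \<psi>)\<in>trivs E. open U \<and>
        (\<forall>x\<in>U. linear (\<psi> x) \<and> bij_betw (\<psi> x) (fibre E x) UNIV)) \<and>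
     (\<Union>(U, \<psi>)\<in>trivs E. U) = UNIV \<and>
     (\<forall>(U, \<psi>)\<in>trivs E. \<forall>(V, \<theta>)\<in>trivs E. \<forall>w.
        smooth_map_on (atlas E) (U \<inter> V) (\<lambda>x. \<theta> x (inv_into (fibre E x) (\<psi> x) w)))"

text \<open>Smooth sections over an open set \<open>W\<close>; values outside \<open>W\<close> are irrelevant. The set of
  global sections is \<open>sections E UNIV\<close>.\<close>
definition sections ::
  "('p::topological_space, 'm::euclidean_space, 'e::real_vector, 'f::euclidean_space) vbundle
     \<Rightarrow> 'p set \<Rightarrow> ('p \<Rightarrow> 'e) set" where
  "sections E W = {u. (\<forall>x\<in>W. u x \<in> fibre E x) \<and>
     (\<forall>(U, \<psi>)\<in>trivs E. smooth_map_on (atlas E) (U \<inter> W) (\<lambda>x. \<psi> x (u x)))}"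


section \<open>The gauge algebroid\<close>

text \<open>\<open>\<dd>(fu) = \<sigma>(\<dd>)(f) u + f \<dd>u\<close> for a derivation with symbol \<open>X\<close>.\<close>
definition derivation ::
  "('p::topological_space, 'm::euclidean_space, 'e::real_vector, 'f::euclidean_space) vbundle
     \<Rightarrow> (('p \<Rightarrow> 'e) \<Rightarrow> 'p \<Rightarrow> 'e) \<Rightarrow> bool" where
  "derivation E d \<longleftrightarrow>
     (\<forall>u\<in>sections E UNIV. d u \<in> sections E UNIV) \<and>
     (\<forall>u\<in>sections E UNIV. \<forall>w\<in>sections E UNIV. d (u + w) = d u + d w) \<and>
     (\<forall>u\<in>sections E UNIV. \<forall>c. d (c *\<^sub>R u) = c *\<^sub>R d u) \<and>
     (\<exists>X\<in>vector_fields (atlas E) UNIV. \<forall>f\<in>smooth_functions (atlas E). \<forall>u\<in>sections E UNIV.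
        d (\<lambda>x. f x *\<^sub>R u x) = (\<lambda>x. X x f *\<^sub>R u x + f x *\<^sub>R d u x))"

text \<open>The fibre at \<open>x\<close> of the gauge algebroid consists of the derivations at \<open>x\<close>, i.e. the
  linear maps from global sections to the fibre of \<open>E\<close> at \<open>x\<close> satisfying the Leibniz rule
  at \<open>x\<close> for some tangent vector at \<open>x\<close>, the symbol.\<close>
definition has_symbol ::
  "('p::topological_space, 'm::euclidean_space, 'e::real_vector, 'f::euclidean_space) vbundle
     \<Rightarrow> 'p \<Rightarrow> (('p \<Rightarrow> 'e) \<Rightarrow> 'e) \<Rightarrow> (('p \<Rightarrow> real) \<Rightarrow> real) \<Rightarrow> bool" where
  "has_symbol E x \<delta> v \<longleftrightarrow> v \<in> tangent_space (atlas E) x \<and>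
     (\<forall>f\<in>smooth_functions (atlas E). \<forall>u\<in>sections E UNIV.
        \<delta> (\<lambda>y. f y *\<^sub>R u y) = v f *\<^sub>R u x + f x *\<^sub>R \<delta> u)"

definition gauge_fibre ::
  "('p::topological_space, 'm::euclidean_space, 'e::real_vector, 'f::euclidean_space) vbundle
     \<Rightarrow> 'p \<Rightarrow> (('p \<Rightarrow> 'e) \<Rightarrow> 'e) set" where
  "gauge_fibre E x = {\<delta>.
     (\<forall>u\<in>sections E UNIV. \<delta> u \<in> fibre E x) \<and>
     (\<forall>u\<in>sections E UNIV. \<forall>w\<in>sections E UNIV. \<delta> (u + w) = \<delta> u + \<delta> w) \<and>
     (\<forall>u\<in>sections E UNIV. \<forall>c. \<delta> (c *\<^sub>R u) = c *\<^sub>R \<delta> u) \<and>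
     (\<exists>v. has_symbol E x \<delta> v) \<and>
     (\<forall>u. u \<notin> sections E UNIV \<longrightarrow> \<delta> u = 0)}"

text \<open>The symbol is unique because the rank \<open>DIM('f)\<close> is positive.\<close>
definition symbol ::
  "('p::topological_space, 'm::euclidean_space, 'e::real_vector, 'f::euclidean_space) vbundle
     \<Rightarrow> 'p \<Rightarrow> (('p \<Rightarrow> 'e) \<Rightarrow> 'e) \<Rightarrow> ('p \<Rightarrow> real) \<Rightarrow> real" where
  "symbol E x \<delta> = (THE v. has_symbol E x \<delta> v)"

text \<open>An endomorphism \<open>\<Phi>\<close> of the fibre at \<open>x\<close> as a derivation at \<open>x\<close> with zero symbol.\<close>
definition endo_derivation ::
  "('p::topological_space, 'm::euclidean_space, 'e::real_vector, 'f::euclidean_space) vbundle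
     \<Rightarrow> 'p \<Rightarrow> ('e \<Rightarrow> 'e) \<Rightarrow> ('p \<Rightarrow> 'e) \<Rightarrow> 'e" where
  "endo_derivation E x \<Phi> = (\<lambda>u. if u \<in> sections E UNIV then \<Phi> (u x) else 0)"

definition gauge_sections ::
  "('p::topological_space, 'm::euclidean_space, 'e::real_vector, 'f::euclidean_space) vbundle
     \<Rightarrow> 'p set \<Rightarrow> ('p \<Rightarrow> ('p \<Rightarrow> 'e) \<Rightarrow> 'e) set" where
  "gauge_sections E W = {D. (\<forall>x\<in>W. D x \<in> gauge_fibre E x) \<and>
     (\<forall>u\<in>sections E UNIV. (\<lambda>x. D x u) \<in> sections E W) \<and>
     (\<exists>X\<in>vector_fields (atlas E) W. \<forall>x\<in>W. has_symbol E x (D x) (X x))}"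

text \<open>Global sections of the gauge algebroid are exactly the derivations.\<close>
lemma gauge_sections_UNIV_iff:
  "D \<in> gauge_sections E UNIV \<longleftrightarrow>
     derivation E (\<lambda>u x. D x u) \<and> (\<forall>x u. u \<notin> sections E UNIV \<longrightarrow> D x u = 0)"
proof
  assume D: "D \<in> gauge_sections E UNIV"
  then show "derivation E (\<lambda>u x. D x u) \<and> (\<forall>x u. u \<notin> sections E UNIV \<longrightarrow> D x u = 0)"
    by (auto simp: gauge_sections_def derivation_def gauge_fibre_def has_symbol_def
        fun_eq_iff scaleR_fun_def)
next
  assume D: "derivation E (\<lambda>u x. D x u) \<and> (\<forall>x u. u \<notin> sections E UNIV \<longrightarrow> D x u = 0)"
  then obtain X where X: "X \<in> vector_fields (atlas E) UNIV"
    and L: "\<And>f u. f \<in> smooth_functions (atlas E) \<Longrightarrow> u \<in> sections E UNIV \<Longrightarrow>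
      (\<lambda>x. D x (\<lambda>y. f y *\<^sub>R u y)) = (\<lambda>x. X x f *\<^sub>R u x + f x *\<^sub>R D x u)"
    unfolding derivation_def by blast
  have S: "has_symbol E x (D x) (X x)" for x
    using X fun_cong[OF L, of _ _ x] by (auto simp: has_symbol_def vector_fields_def)
  have "D x \<in> gauge_fibre E x" for x
    unfolding gauge_fibre_def
  proof (intro CollectI conjI ballI allI impI)
    fix u assume u: "u \<in> sections E UNIV"
    then have "(\<lambda>x. D x u) \<in> sections E UNIV" using D by (auto simp: derivation_def)
    then show "D x u \<in> fibre E x" by (simp add: sections_def)
    show "D x (c *\<^sub>R u) = c *\<^sub>R D x u" for c
      using D u by (auto simp: derivation_def fun_eq_iff scaleR_fun_def)
    show "D x (u + w) = D x u + D x w" if "w \<in> sections E UNIV" for w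
      using D u that by (auto simp: derivation_def fun_eq_iff)
  qed (use S D in auto)
  then show "D \<in> gauge_sections E UNIV"
    using D S X by (auto simp: gauge_sections_def derivation_def)
qed

definition gauge_bracket ::
  "('p \<Rightarrow> ('p \<Rightarrow> 'e) \<Rightarrow> 'e::real_vector) \<Rightarrow> ('p \<Rightarrow> ('p \<Rightarrow> 'e) \<Rightarrow> 'e)
     \<Rightarrow> 'p \<Rightarrow> ('p \<Rightarrow> 'e) \<Rightarrow> 'e" where
  "gauge_bracket D R = (\<lambda>x u. D x (\<lambda>y. R y u) - R x (\<lambda>y. D y u))"


section \<open>Forms with values in the bundle\<close>

text \<open>\<open>Hom(\<Lambda>\<^sup>k V, W)\<close>: alternating \<open>k\<close>-linear maps, with the arguments collected in a list
  of length \<open>k\<close>.\<close>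
definition alt_maps ::
  "nat \<Rightarrow> 'v::real_vector set \<Rightarrow> 'w::real_vector set \<Rightarrow> ('v list \<Rightarrow> 'w) set" where
  "alt_maps k V W = {\<mu>.
     (\<forall>vs. length vs = k \<and> set vs \<subseteq> V \<longrightarrow>
        \<mu> vs \<in> W \<and>
        (\<forall>i<k. \<forall>a\<in>V. \<forall>b\<in>V. \<mu> (vs[i := a + b]) = \<mu> (vs[i := a]) + \<mu> (vs[i := b])) \<and>
        (\<forall>i<k. \<forall>a\<in>V. \<forall>c. \<mu> (vs[i := c *\<^sub>R a]) = c *\<^sub>R \<mu> (vs[i := a])) \<and>
        (\<forall>i<k. \<forall>j<k. i \<noteq> j \<and> vs ! i = vs ! j \<longrightarrow> \<mu> vs = 0)) \<and>
     (\<forall>vs. \<not> (length vs = k \<and> set vs \<subseteq> V) \<longrightarrow> \<mu> vs = 0)}"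

definition contraction :: "'v \<Rightarrow> ('v list \<Rightarrow> 'w) \<Rightarrow> 'v list \<Rightarrow> 'w" where
  "contraction v \<mu> = (\<lambda>vs. \<mu> (v # vs))"

text \<open>The fibre at \<open>x\<close> of \<open>\<JJ>\<^sub>k E\<close>. Endomorphisms of the fibre of \<open>E\<close> are given by linear
  extensions to the ambient space.\<close>
definition J_fibre ::
  "('p::topological_space, 'm::euclidean_space, 'e::real_vector, 'f::euclidean_space) vbundle
     \<Rightarrow> nat \<Rightarrow> 'p \<Rightarrow> ((('p \<Rightarrow> 'e) \<Rightarrow> 'e) list \<Rightarrow> 'e) set" where
  "J_fibre E k x = {\<mu> \<in> alt_maps k (gauge_fibre E x) (fibre E x).
     k = 0 \<or>
     (\<exists>\<eta>\<in>alt_maps (k - 1) (tangent_space (atlas E) x) (fibre E x).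
        \<forall>\<Phi>. linear \<Phi> \<and> \<Phi> ` fibre E x \<subseteq> fibre E x \<longrightarrow>
          (\<forall>\<delta>s. length \<delta>s = k - 1 \<and> set \<delta>s \<subseteq> gauge_fibre E x \<longrightarrow>
             contraction (endo_derivation E x \<Phi>) \<mu> \<delta>s = \<Phi> (\<eta> (map (symbol E x) \<delta>s))))}"

text \<open>The map on tuples of sections induced by a field of forms.\<close>
definition form_eval ::
  "('p \<Rightarrow> 'v list \<Rightarrow> 'w) \<Rightarrow> ('p \<Rightarrow> 'v) list \<Rightarrow> 'p \<Rightarrow> 'w" where
  "form_eval \<omega> Ds = (\<lambda>x. \<omega> x (map (\<lambda>D. D x) Ds))"

text \<open>A section of \<open>Hom(\<Lambda>\<^sup>k \<DD>E, E)\<close> is smooth iff it takes smooth sections to smooth sections.\<close>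
definition J_sections ::
  "('p::topological_space, 'm::euclidean_space, 'e::real_vector, 'f::euclidean_space) vbundle
     \<Rightarrow> nat \<Rightarrow> 'p set \<Rightarrow> ('p \<Rightarrow> (('p \<Rightarrow> 'e) \<Rightarrow> 'e) list \<Rightarrow> 'e) set" where
  "J_sections E k W = {\<omega>. (\<forall>x\<in>W. \<omega> x \<in> J_fibre E k x) \<and>
     (\<forall>Ds. length Ds = k \<and> set Ds \<subseteq> gauge_sections E UNIV \<longrightarrow> form_eval \<omega> Ds \<in> sections E W)}"

text \<open>The Cartan calculus, for forms regarded as maps on tuples of global sections of the gauge
  algebroid. The term \<open>nths Ds (- {i})\<close> is \<open>Ds\<close> without its \<open>i\<close>-th entry.\<close>
definition gauge_d ::
  "(('p \<Rightarrow> ('p \<Rightarrow> 'e) \<Rightarrow> 'e::real_vector) list \<Rightarrow> 'p \<Rightarrow> 'e)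
     \<Rightarrow> ('p \<Rightarrow> ('p \<Rightarrow> 'e) \<Rightarrow> 'e) list \<Rightarrow> 'p \<Rightarrow> 'e" where
  "gauge_d \<mu> Ds = (\<lambda>x.
     (\<Sum>i<length Ds. (-1) ^ i *\<^sub>R (Ds ! i) x (\<mu> (nths Ds (- {i})))) +
     (\<Sum>j<length Ds. \<Sum>i<j.
        (-1) ^ (i + j) *\<^sub>R \<mu> (gauge_bracket (Ds ! i) (Ds ! j) # nths Ds (- {i, j})) x))"

definition gauge_lie ::
  "('p \<Rightarrow> ('p \<Rightarrow> 'e) \<Rightarrow> 'e::real_vector)
     \<Rightarrow> (('p \<Rightarrow> ('p \<Rightarrow> 'e) \<Rightarrow> 'e) list \<Rightarrow> 'p \<Rightarrow> 'e)
     \<Rightarrow> ('p \<Rightarrow> ('p \<Rightarrow> 'e) \<Rightarrow> 'e) list \<Rightarrow> 'p \<Rightarrow> 'e" where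
  "gauge_lie D \<mu> = contraction D (gauge_d \<mu>) + gauge_d (contraction D \<mu>)"


section \<open>The higher omni-Lie algebroid\<close>

type_synonym ('p, 'e) omni = "(('p \<Rightarrow> 'e) \<Rightarrow> 'e) \<times> ((('p \<Rightarrow> 'e) \<Rightarrow> 'e) list \<Rightarrow> 'e)"

definition omni_fibre ::
  "('p::topological_space, 'm::euclidean_space, 'e::real_vector, 'f::euclidean_space) vbundle
     \<Rightarrow> nat \<Rightarrow> 'p \<Rightarrow> ('p, 'e) omni set" where
  "omni_fibre E n x = gauge_fibre E x \<times> J_fibre E n x"

definition omni_sections ::
  "('p::topological_space, 'm::euclidean_space, 'e::real_vector, 'f::euclidean_space) vbundle
     \<Rightarrow> nat \<Rightarrow> 'p set \<Rightarrow> ('p \<Rightarrow> ('p, 'e) omni) set" where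
  "omni_sections E n W =
     {e. fst \<circ> e \<in> gauge_sections E W \<and> snd \<circ> e \<in> J_sections E n W}"

definition pairing ::
  "('p, 'e::real_vector) omni \<Rightarrow> ('p, 'e) omni \<Rightarrow> (('p \<Rightarrow> 'e) \<Rightarrow> 'e) list \<Rightarrow> 'e" where
  "pairing e1 e2 =
     (1/2) *\<^sub>R (contraction (fst e1) (snd e2) + contraction (fst e2) (snd e1))"

text \<open>The form component of the bracket is given as a map on tuples of sections.\<close>
definition omni_bracket ::
  "('p \<Rightarrow> ('p, 'e::real_vector) omni) \<Rightarrow> ('p \<Rightarrow> ('p, 'e) omni)
     \<Rightarrow> ('p \<Rightarrow> ('p \<Rightarrow> 'e) \<Rightarrow> 'e) \<times> (('p \<Rightarrow> ('p \<Rightarrow> 'e) \<Rightarrow> 'e) list \<Rightarrow> 'p \<Rightarrow> 'e)" where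
  "omni_bracket e1 e2 =
     (gauge_bracket (fst \<circ> e1) (fst \<circ> e2),
      gauge_lie (fst \<circ> e1) (form_eval (snd \<circ> e2))
        - contraction (fst \<circ> e2) (gauge_d (form_eval (snd \<circ> e1))))"

text \<open>Sections of a subbundle over an open set \<open>W\<close>.\<close>
definition sub_sections ::
  "('p::topological_space, 'm::euclidean_space, 'e::real_vector, 'f::euclidean_space) vbundle
     \<Rightarrow> nat \<Rightarrow> ('p \<Rightarrow> ('p, 'e) omni set) \<Rightarrow> 'p set \<Rightarrow> ('p \<Rightarrow> ('p, 'e) omni) set" where
  "sub_sections E n L W = {e \<in> omni_sections E n W. \<forall>x\<in>W. e x \<in> L x}"

text \<open>A subbundle is a field of subspaces that locally has a smooth frame.\<close>
definition subbundle ::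
  "('p::topological_space, 'm::euclidean_space, 'e::real_vector, 'f::euclidean_space) vbundle
     \<Rightarrow> nat \<Rightarrow> ('p \<Rightarrow> ('p, 'e) omni set) \<Rightarrow> bool" where
  "subbundle E n L \<longleftrightarrow>
     (\<forall>x. subspace (L x) \<and> L x \<subseteq> omni_fibre E n x) \<and>
     (\<forall>x. \<exists>U r (s :: nat \<Rightarrow> 'p \<Rightarrow> ('p, 'e) omni). open U \<and> x \<in> U \<and>
        (\<forall>i<r. s i \<in> sub_sections E n L U) \<and>
        (\<forall>y\<in>U. inj_on (\<lambda>i. s i y) {..<r} \<and> independent ((\<lambda>i. s i y) ` {..<r}) \<and>
           span ((\<lambda>i. s i y) ` {..<r}) = L y))"

definition isotropic :: "('p \<Rightarrow> ('p, 'e::real_vector) omni set) \<Rightarrow> bool" where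
  "isotropic L \<longleftrightarrow> (\<forall>x. \<forall>e1\<in>L x. \<forall>e2\<in>L x. pairing e1 e2 = 0)"

text \<open>The bracket of two sections is a section \<open>e\<close> of \<open>L\<close>; the form component of \<open>e\<close> is
  compared with that of the bracket by its values on tuples of sections.\<close>
definition involutive ::
  "('p::topological_space, 'm::euclidean_space, 'e::real_vector, 'f::euclidean_space) vbundle
     \<Rightarrow> nat \<Rightarrow> ('p \<Rightarrow> ('p, 'e) omni set) \<Rightarrow> bool" where
  "involutive E n L \<longleftrightarrow>
     (\<forall>e1\<in>sub_sections E n L UNIV. \<forall>e2\<in>sub_sections E n L UNIV.
        \<exists>e\<in>sub_sections E n L UNIV.
          fst \<circ> e = fst (omni_bracket e1 e2) \<and>
          (\<forall>Ds. length Ds = n \<and> set Ds \<subseteq> gauge_sections E UNIV \<longrightarrow>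
             form_eval (snd \<circ> e) Ds = snd (omni_bracket e1 e2) Ds))"

definition maximal_isotropic ::
  "('p::topological_space, 'm::euclidean_space, 'e::real_vector, 'f::euclidean_space) vbundle
     \<Rightarrow> nat \<Rightarrow> ('p \<Rightarrow> ('p, 'e) omni set) \<Rightarrow> bool" where
  "maximal_isotropic E n L \<longleftrightarrow> subbundle E n L \<and> isotropic L \<and>
     (\<forall>L'. subbundle E n L' \<and> isotropic L' \<and> (\<forall>x. L x \<subseteq> L' x) \<longrightarrow> L' = L)"

definition higher_dirac_jacobi ::
  "('p::topological_space, 'm::euclidean_space, 'e::real_vector, 'f::euclidean_space) vbundle
     \<Rightarrow> nat \<Rightarrow> ('p \<Rightarrow> ('p, 'e) omni set) \<Rightarrow> bool" where
  "higher_dirac_jacobi E n L \<longleftrightarrow> maximal_isotropic E n L \<and> involutive E n L"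

text \<open>The restricted projection is an isomorphism of vector bundles: a fibrewise linear bijection
  which, together with its inverse, preserves smoothness of local sections.

  For a line bundle over a manifold of dimension \<open>n\<close>, \<open>\<JJ>\<^sub>n E\<close> is all of
  \<open>Hom(\<Lambda>\<^sup>n \<DD>E, E)\<close> and has the same rank \<open>n + 1\<close> as \<open>\<DD>E\<close>. Hence, if \<open>\<omega>\<close> is a nowhere
  vanishing section of \<open>Hom(\<Lambda>\<^sup>n\<^sup>+\<^sup>1 \<DD>E, E)\<close>, its graph, i.e. the set of all
  \<open>(\<delta>, \<iota>\<^sub>\<delta> \<omega>)\<close>, is isotropic and projects isomorphically onto \<open>\<JJ>\<^sub>n E\<close> without being
  \<open>0 \<oplus> \<JJ>\<^sub>n E\<close>; the rigidity theorem has to exclude this case.\<close>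
definition projects_isomorphically ::
  "('p::topological_space, 'm::euclidean_space, 'e::real_vector, 'f::euclidean_space) vbundle
     \<Rightarrow> nat \<Rightarrow> ('p \<Rightarrow> ('p, 'e) omni set) \<Rightarrow> bool" where
  "projects_isomorphically E n L \<longleftrightarrow>
     (\<forall>x. bij_betw snd (L x) (J_fibre E n x)) \<and>
     (\<forall>W. open W \<longrightarrow>
        (\<forall>e\<in>sub_sections E n L W. snd \<circ> e \<in> J_sections E n W) \<and>
        (\<forall>\<omega>\<in>J_sections E n W. (\<lambda>x. inv_into (L x) snd (\<omega> x)) \<in> sub_sections E n L W))"

end

theory Submission
  imports Defs
begin

text \<open>
  Fix a point \<open>x\<close>. An isotropic \<open>L\<close> that projects bijectively onto \<open>\<JJ>\<^sub>n E\<close> is, over \<open>x\<close>, the graph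
  of a map \<open>B\<close> from \<open>\<JJ>\<^sub>n E\<close> to the gauge algebroid satisfying
  \<open>\<iota>\<^bsub>B\<mu>\<^esub> \<nu> + \<iota>\<^bsub>B\<nu>\<^esub> \<mu> = 0\<close>. The theorem says that \<open>B = 0\<close>. This is linear algebra at the point \<open>x\<close>, once
  the fibres are known to be large enough: every vector of the fibre of \<open>E\<close> is the value of a global
  section, every tangent vector is the symbol of a derivation at \<open>x\<close>, and the tangent space is not
  spanned by fewer than \<open>dim M\<close> vectors. All three follow from the existence of bump functions.

  The relation is tested on two families of elements of \<open>\<JJ>\<^sub>n E\<close>. The first consists of the forms
  \<open>\<sigma>\<^sup>*\<theta> \<otimes> e\<close>, where \<open>\<theta>\<close> is an \<open>n\<close>-form on the tangent space and \<open>e\<close> a vector of the fibre; they vanish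
  on endomorphisms. The second consists of the forms \<open>du \<and> \<sigma>\<^sup>*\<eta>\<close>, where \<open>\<eta>\<close> is an \<open>(n - 1)\<close>-form, \<open>u\<close> a
  section and \<open>du(\<delta>) = \<delta>u\<close>; contraction with an endomorphism \<open>\<Phi>\<close> gives \<open>\<sigma>\<^sup>*\<eta> \<otimes> \<Phi>(u(x))\<close>. Inserting the
  identity endomorphism into the relation for two forms of the second kind yields
  \<open>\<iota>\<^bsub>X\<^esub> \<eta>' \<otimes> u'(x) + \<iota>\<^bsub>X'\<^esub> \<eta> \<otimes> u(x) = 0\<close>  (R)
  where \<open>X\<close> and \<open>X'\<close> are the symbols of the values of \<open>B\<close> on them. Now \<open>B = 0\<close> follows in four steps.

  \<^enum> \<open>B(\<sigma>\<^sup>*\<theta> \<otimes> e)\<close> has symbol zero: the analogue of (R) has only one term, and some \<open>\<iota>\<^bsub>X\<^esub> \<eta>'\<close> is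
    nonzero if \<open>X\<close> is, since \<open>1 \<le> n - 1 \<le> dim M\<close>.

  \<^enum> \<open>B(du \<and> \<sigma>\<^sup>*\<eta>)\<close> has symbol zero. If the rank of \<open>E\<close> is at least two, take \<open>u'(x)\<close> independent of
    \<open>u(x)\<close>, so that (R) decouples. If \<open>n < dim M\<close>, pair with \<open>\<sigma>\<^sup>*\<theta> \<otimes> e\<close> instead: for vectors \<open>r\<close>, the
    relation reads \<open>\<eta>(r) (B(\<sigma>\<^sup>*\<theta> \<otimes> e))u + \<theta>(X, r) e = 0\<close>, and if \<open>X \<noteq> 0\<close> there are \<open>r\<close> and \<open>\<theta>\<close> with
    \<open>\<eta>(r) = 0\<close> and \<open>\<theta>(X, r) \<noteq> 0\<close>. A line bundle with \<open>n = dim M\<close> escapes both arguments.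

  \<^enum> \<open>B(du \<and> \<sigma>\<^sup>*\<eta>) = 0\<close>: for two forms of this kind the relation has become
    \<open>\<eta>'(r) B(du \<and> \<sigma>\<^sup>*\<eta>)u' + \<eta>(r) B(du' \<and> \<sigma>\<^sup>*\<eta>')u = 0\<close>, and as \<open>n - 1 < dim M\<close> one can choose \<open>\<eta>'\<close> and
    \<open>r\<close> such that \<open>\<eta>(r) = 0\<close> and \<open>\<eta>'(r) \<noteq> 0\<close>.

  \<^enum> For arbitrary \<open>\<mu>\<close>, the derivation \<open>B\<mu>\<close> is annihilated by all forms \<open>du \<and> \<sigma>\<^sup>*\<eta>\<close>, and these detect
    derivations (\<open>forms_detect_derivations\<close>).

  The steps are carried out in \<open>isotropic_graph_zero\<close>. The last one also shows that \<open>0 \<oplus> \<JJ>\<^sub>n E\<close> is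
  maximal: an element of a larger isotropic subbundle pairs to zero with \<open>\<JJ>\<^sub>n E\<close>, so its derivation
  vanishes. Involutivity holds because the bracket of two sections of \<open>0 \<oplus> \<JJ>\<^sub>n E\<close> is zero.
\<close>

section \<open>Calculus of smooth maps and a bump function\<close>

lemma times_differentiable_on_pred:
  "times_differentiable_on (Suc k) S f \<Longrightarrow> times_differentiable_on k S f"
proof (induction k arbitrary: f)
  case 0
  then show ?case
    by (auto intro!: continuous_at_imp_continuous_on differentiable_imp_continuous_within)
next
  case (Suc k)
  then show ?case by auto
qed

lemma frechet_derivative_cong:
  assumes "open S" "x \<in> S" "\<And>y. y \<in> S \<Longrightarrow> f y = g y"
  shows "frechet_derivative f (at x) = frechet_derivative g (at x)"
proof -
  have "(f has_derivative D) (at x) \<longleftrightarrow> (g has_derivative D) (at x)" for D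
    using has_derivative_transform_within_open[of f D x UNIV S g]
      has_derivative_transform_within_open[of g D x UNIV S f] assms by auto
  then show ?thesis by (simp add: frechet_derivative_def)
qed

lemma times_differentiable_on_cong:
  assumes "open S" "times_differentiable_on k S f" "\<And>y. y \<in> S \<Longrightarrow> f y = g y"
  shows "times_differentiable_on k S g"
  using assms(2,3)
proof (induction k arbitrary: f g)
  case 0
  then show ?case by (simp cong: continuous_on_cong)
next
  case (Suc k)
  have "g differentiable (at x)" if "x \<in> S" for x
    using Suc.prems that assms(1) has_derivative_transform_within_open[of f _ x UNIV S g]
    unfolding differentiable_def times_differentiable_on.simps by metis
  moreover have "times_differentiable_on k S (\<lambda>x. frechet_derivative g (at x) v)" for v
  proof (rule Suc.IH[of "\<lambda>x. frechet_derivative f (at x) v"])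
    show "times_differentiable_on k S (\<lambda>x. frechet_derivative f (at x) v)"
      using Suc.prems(1) by simp
    show "frechet_derivative f (at y) v = frechet_derivative g (at y) v" if "y \<in> S" for y
      using frechet_derivative_cong[OF assms(1) that Suc.prems(2)] by simp
  qed
  ultimately show ?case by simp
qed

lemma times_differentiable_on_subset:
  "times_differentiable_on k S f \<Longrightarrow> T \<subseteq> S \<Longrightarrow> times_differentiable_on k T f"
  by (induction k arbitrary: f) (auto intro: continuous_on_subset)

lemma times_differentiable_on_Union:
  assumes "\<And>S. S \<in> \<S> \<Longrightarrow> open S" "\<And>S. S \<in> \<S> \<Longrightarrow> times_differentiable_on k S f"
  shows "times_differentiable_on k (\<Union>\<S>) f"
  using assms(2)
proof (induction k arbitrary: f)
  case 0
  then show ?case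
    using continuous_on_open_Union[of \<S> f] assms(1) by auto
next
  case (Suc k)
  then show ?case by auto
qed

lemma times_differentiable_on_const: "times_differentiable_on k S (\<lambda>x. c)"
  by (induction k arbitrary: c) auto

lemma times_differentiable_on_add:
  assumes "open S" "times_differentiable_on k S f" "times_differentiable_on k S g"
  shows "times_differentiable_on k S (\<lambda>x. f x + g x)"
  using assms(2,3)
proof (induction k arbitrary: f g)
  case 0
  then show ?case by (auto intro: continuous_on_add)
next
  case (Suc k)
  have D: "((\<lambda>x. f x + g x) has_derivative
      (\<lambda>v. frechet_derivative f (at x) v + frechet_derivative g (at x) v)) (at x)"
    if "x \<in> S" for x
    using Suc.prems that by (auto intro!: has_derivative_add simp flip: frechet_derivative_works)
  have "times_differentiable_on k S (\<lambda>x. frechet_derivative (\<lambda>x. f x + g x) (at x) v)" for v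
  proof (rule times_differentiable_on_cong[OF assms(1)])
    show "times_differentiable_on k S
        (\<lambda>x. frechet_derivative f (at x) v + frechet_derivative g (at x) v)"
      using Suc.prems by (intro Suc.IH) auto
    show "frechet_derivative f (at y) v + frechet_derivative g (at y) v
        = frechet_derivative (\<lambda>x. f x + g x) (at y) v" if "y \<in> S" for y
      using frechet_derivative_at[OF D[OF that]] by metis
  qed
  with D show ?case by (auto simp: differentiable_def)
qed

lemma times_differentiable_on_bilinear:
  assumes "bounded_bilinear B"
    and "open S" "times_differentiable_on k S f" "times_differentiable_on k S g"
  shows "times_differentiable_on k S (\<lambda>x. B (f x) (g x))"
  using assms(3,4)
proof (induction k arbitrary: f g)
  case 0
  then show ?case by (auto intro: bounded_bilinear.continuous_on[OF assms(1)])
next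
  case (Suc k)
  have D: "((\<lambda>x. B (f x) (g x)) has_derivative (\<lambda>v. B (f x) (frechet_derivative g (at x) v)
      + B (frechet_derivative f (at x) v) (g x))) (at x)" if "x \<in> S" for x
    using Suc.prems that
    by (auto intro!: bounded_bilinear.FDERIV[OF assms(1)] simp flip: frechet_derivative_works)
  have "times_differentiable_on k S (\<lambda>x. frechet_derivative (\<lambda>x. B (f x) (g x)) (at x) v)" for v
  proof (rule times_differentiable_on_cong[OF assms(2)])
    show "times_differentiable_on k S (\<lambda>x. B (f x) (frechet_derivative g (at x) v)
      + B (frechet_derivative f (at x) v) (g x))"
      using Suc.prems times_differentiable_on_pred[of k S f] times_differentiable_on_pred[of k S g]
      by (intro times_differentiable_on_add[OF assms(2)] Suc.IH) auto
    show "B (f y) (frechet_derivative g (at y) v) + B (frechet_derivative f (at y) v) (g y)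
        = frechet_derivative (\<lambda>x. B (f x) (g x)) (at y) v" if "y \<in> S" for y
      using frechet_derivative_at[OF D[OF that]] by metis
  qed
  with D show ?case by (auto simp: differentiable_def)
qed

lemmas times_differentiable_on_scaleR =
  times_differentiable_on_bilinear[OF bounded_bilinear_scaleR]

lemma times_differentiable_on_compose_real:
  fixes h :: "real \<Rightarrow> real"
  assumes "open S" "times_differentiable_on k UNIV h" "times_differentiable_on k S f"
  shows "times_differentiable_on k S (\<lambda>x. h (f x))"
  using assms(2,3)
proof (induction k arbitrary: h)
  case 0
  then show ?case using continuous_on_compose2[of UNIV h S f] by auto
next
  case (Suc k)
  have h: "(h has_derivative (\<lambda>c. c * frechet_derivative h (at t) 1)) (at t)" for t
  proof -
    have D: "(h has_derivative frechet_derivative h (at t)) (at t)"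
      using Suc.prems(1) by (simp flip: frechet_derivative_works)
    have "frechet_derivative h (at t) c = c * frechet_derivative h (at t) 1" for c
      using linear_scale[OF has_derivative_linear[OF D], of c 1] by simp
    then have "frechet_derivative h (at t) = (\<lambda>c. c * frechet_derivative h (at t) 1)" by (rule ext)
    with D show ?thesis by simp
  qed
  have D: "((\<lambda>x. h (f x)) has_derivative
      (\<lambda>v. frechet_derivative f (at x) v *\<^sub>R frechet_derivative h (at (f x)) 1)) (at x)"
    if "x \<in> S" for x
    using has_derivative_compose[OF _ h, of f "frechet_derivative f (at x)" x UNIV] Suc.prems that
    by (auto simp flip: frechet_derivative_works)
  have "times_differentiable_on k S (\<lambda>x. frechet_derivative (\<lambda>x. h (f x)) (at x) v)" for v
  proof (rule times_differentiable_on_cong[OF assms(1)])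
    show "times_differentiable_on k S
        (\<lambda>x. frechet_derivative f (at x) v *\<^sub>R frechet_derivative h (at (f x)) 1)"
      using Suc.prems times_differentiable_on_pred[of k S f]
      by (intro times_differentiable_on_scaleR assms(1)
          Suc.IH[of "\<lambda>t. frechet_derivative h (at t) 1"]) auto
    show "frechet_derivative f (at y) v *\<^sub>R frechet_derivative h (at (f y)) 1
        = frechet_derivative (\<lambda>x. h (f x)) (at y) v" if "y \<in> S" for y
      using frechet_derivative_at[OF D[OF that]] by metis
  qed
  with D show ?case by (auto simp: differentiable_def)
qed

text \<open>The family is indexed by all polynomials so that it is closed under differentiation; smoothness of
every member then needs only one derivative. The member of index \<open>1\<close> is the classical flat function
\<open>exp (- 1 / t)\<close>.\<close>

definition flat_exp :: "real poly \<Rightarrow> real \<Rightarrow> real" where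
  "flat_exp p t = (if t \<le> 0 then 0 else poly p (1 / t) * exp (- (1 / t)))"

lemma poly_times_exp_minus_tendsto_0: "((\<lambda>s. poly p s * exp (- s)) \<longlongrightarrow> 0) (at_top :: real filter)"
proof -
  have "((\<lambda>s::real. s ^ i * exp (- s)) \<longlongrightarrow> 0) at_top" for i
    using tendsto_power_div_exp_0[of i] by (simp add: exp_minus field_simps)
  then have "((\<lambda>s. \<Sum>i\<le>degree p. coeff p i * (s ^ i * exp (- s))) \<longlongrightarrow> (\<Sum>i\<le>degree p. coeff p i * 0)) at_top"
    by (intro tendsto_sum tendsto_mult_left)
  then show ?thesis by (simp add: poly_altdef sum_distrib_right mult.assoc)
qed

lemma flat_exp_has_derivative:
  "(flat_exp p has_field_derivative flat_exp ((p - pderiv p) * [:0, 0, 1:]) t) (at t)"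
proof -
  let ?q = "(p - pderiv p) * [:0, 0, 1:]"
  consider "t < 0" | "t = 0" | "t > 0" by linarith
  then show ?thesis
  proof cases
    case 1
    have "((\<lambda>_. 0) has_field_derivative 0) (at t)" by simp
    then have "(flat_exp p has_field_derivative 0) (at t)"
      by (rule DERIV_cong_ev[THEN iffD1, rotated -1, OF _ refl _ refl])
        (use 1 eventually_nhds_in_open[of "{..<0}" t] in
          \<open>auto elim!: eventually_mono simp: flat_exp_def\<close>)
    with 1 show ?thesis by (simp add: flat_exp_def)
  next
    case 3
    have "((\<lambda>t. poly p (1 / t) * exp (- (1 / t))) has_field_derivative flat_exp ?q t) (at t)"
      using 3
      by (auto intro!: derivative_eq_intros DERIV_chain2[OF poly_DERIV]
          simp: flat_exp_def field_simps power2_eq_square)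
    then show ?thesis
      by (rule DERIV_cong_ev[THEN iffD1, rotated -1, OF _ refl _ refl])
        (use 3 eventually_nhds_in_open[of "{0<..}" t] in
          \<open>auto elim!: eventually_mono simp: flat_exp_def\<close>)
  next
    case 2
    have "((\<lambda>s. poly (p * [:0, 1:]) s * exp (- s)) \<longlongrightarrow> 0) at_top"
      by (rule poly_times_exp_minus_tendsto_0)
    from filterlim_compose[OF this filterlim_inverse_at_top_right]
    have "((\<lambda>t. poly (p * [:0, 1:]) (1 / t) * exp (- (1 / t))) \<longlongrightarrow> 0) (at_right 0)"
      by (simp only: inverse_eq_divide)
    then have R: "((\<lambda>t. flat_exp p t / t) \<longlongrightarrow> 0) (at_right 0)"
      by (rule Lim_transform_eventually)
        (auto simp: flat_exp_def eventually_at_right_less eventually_at_filter)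
    have L: "((\<lambda>t. flat_exp p t / t) \<longlongrightarrow> 0) (at_left 0)"
      by (rule Lim_transform_eventually[OF tendsto_const])
        (auto simp: flat_exp_def eventually_at_filter)
    have "((\<lambda>t. flat_exp p t / t) \<longlongrightarrow> 0) (at 0)"
      using L R by (simp add: filterlim_split_at)
    with 2 show ?thesis by (simp add: has_field_derivative_iff flat_exp_def)
  qed
qed

lemma times_differentiable_flat_exp: "times_differentiable_on k UNIV (flat_exp p)"
proof (induction k arbitrary: p)
  case 0
  show ?case
    using DERIV_isCont[OF flat_exp_has_derivative] by (simp add: continuous_at_imp_continuous_on)
next
  case (Suc k)
  let ?q = "(p - pderiv p) * [:0, 0, 1:]"
  have D: "(flat_exp p has_derivative (\<lambda>v. v *\<^sub>R flat_exp ?q t)) (at t)" for t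
    using flat_exp_has_derivative[of p t] by (simp add: has_field_derivative_def mult_commute_abs)
  have "frechet_derivative (flat_exp p) (at t) v = v *\<^sub>R flat_exp ?q t" for t v
    using frechet_derivative_at[OF D] by metis
  moreover have "times_differentiable_on k UNIV (\<lambda>t. v *\<^sub>R flat_exp ?q t)" for v :: real
    by (intro times_differentiable_on_scaleR times_differentiable_on_const Suc.IH open_UNIV)
  moreover have "flat_exp p differentiable (at t)" for t
    using D unfolding differentiable_def by blast
  ultimately show ?case by simp
qed

section \<open>Alternating maps and wedge products\<close>

lemma alt_maps_mem: "\<mu> \<in> alt_maps k V W \<Longrightarrow> length vs = k \<Longrightarrow> set vs \<subseteq> V \<Longrightarrow> \<mu> vs \<in> W"
  by (simp add: alt_maps_def)

lemma alt_maps_outside: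
  "\<mu> \<in> alt_maps k V W \<Longrightarrow> \<not> (length vs = k \<and> set vs \<subseteq> V) \<Longrightarrow> \<mu> vs = 0"
  by (simp add: alt_maps_def)

lemma alt_maps_add:
  assumes "\<mu> \<in> alt_maps k V W" "length (xs @ ys) + 1 = k" "set xs \<subseteq> V" "set ys \<subseteq> V" "a \<in> V" "b \<in> V"
  shows "\<mu> (xs @ (a + b) # ys) = \<mu> (xs @ a # ys) + \<mu> (xs @ b # ys)"
proof -
  have "\<forall>i<k. \<forall>a\<in>V. \<forall>b\<in>V. \<mu> ((xs @ a # ys)[i := a + b])
      = \<mu> ((xs @ a # ys)[i := a]) + \<mu> ((xs @ a # ys)[i := b])"
    using assms unfolding alt_maps_def by auto
  from this[rule_format, of "length xs" a b] show ?thesis using assms by simp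
qed

lemma alt_maps_scaleR:
  assumes "\<mu> \<in> alt_maps k V W" "length (xs @ ys) + 1 = k" "set xs \<subseteq> V" "set ys \<subseteq> V" "a \<in> V"
  shows "\<mu> (xs @ (c *\<^sub>R a) # ys) = c *\<^sub>R \<mu> (xs @ a # ys)"
proof -
  have "\<forall>i<k. \<forall>a\<in>V. \<forall>c. \<mu> ((xs @ a # ys)[i := c *\<^sub>R a]) = c *\<^sub>R \<mu> ((xs @ a # ys)[i := a])"
    using assms unfolding alt_maps_def by auto
  from this[rule_format, of "length xs" a c] show ?thesis using assms by simp
qed

lemma alt_maps_repeated:
  assumes "\<mu> \<in> alt_maps k V W"
  shows "\<mu> (xs @ a # ys @ a # zs) = 0"
proof (cases "length (xs @ a # ys @ a # zs) = k \<and> set (xs @ a # ys @ a # zs) \<subseteq> V")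
  case True
  have "\<forall>i<k. \<forall>j<k. i \<noteq> j \<and> (xs @ a # ys @ a # zs) ! i = (xs @ a # ys @ a # zs) ! j
      \<longrightarrow> \<mu> (xs @ a # ys @ a # zs) = 0"
    using assms True unfolding alt_maps_def by blast
  from this[rule_format, of "length xs" "length xs + length ys + 1"] True
  show ?thesis by (auto simp: nth_append)
next
  case False
  with assms show ?thesis by (rule alt_maps_outside)
qed

lemma alt_maps_zero_arg:
  assumes "\<mu> \<in> alt_maps k V W" "0 \<in> set vs"
  shows "\<mu> vs = 0"
proof (cases "length vs = k \<and> set vs \<subseteq> V")
  case True
  obtain xs ys where vs: "vs = xs @ 0 # ys" using assms(2) by (meson split_list)
  show ?thesis using alt_maps_scaleR[OF assms(1), of xs ys 0 0] True unfolding vs by auto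
next
  case False
  with assms(1) show ?thesis by (rule alt_maps_outside)
qed

text \<open>Splitting the argument list at the relevant positions, instead of updating it by index, is the form in
which multilinearity and alternation are easiest to verify for wedge products.\<close>

lemma alt_mapsI:
  assumes mem: "\<And>vs. length vs = k \<Longrightarrow> set vs \<subseteq> V \<Longrightarrow> \<mu> vs \<in> W"
    and add: "\<And>xs ys a b. length (xs @ ys) + 1 = k \<Longrightarrow> set xs \<subseteq> V \<Longrightarrow> set ys \<subseteq> V \<Longrightarrow> a \<in> V \<Longrightarrow> b \<in> V
      \<Longrightarrow> \<mu> (xs @ (a + b) # ys) = \<mu> (xs @ a # ys) + \<mu> (xs @ b # ys)"
    and scale: "\<And>xs ys a c. length (xs @ ys) + 1 = k \<Longrightarrow> set xs \<subseteq> V \<Longrightarrow> set ys \<subseteq> V \<Longrightarrow> a \<in> V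
      \<Longrightarrow> \<mu> (xs @ (c *\<^sub>R a) # ys) = c *\<^sub>R \<mu> (xs @ a # ys)"
    and rep: "\<And>xs ys zs a. length (xs @ ys @ zs) + 2 = k \<Longrightarrow> set (xs @ ys @ zs) \<subseteq> V \<Longrightarrow> a \<in> V
      \<Longrightarrow> \<mu> (xs @ a # ys @ a # zs) = 0"
    and outside: "\<And>vs. \<not> (length vs = k \<and> set vs \<subseteq> V) \<Longrightarrow> \<mu> vs = 0"
  shows "\<mu> \<in> alt_maps k V W"
proof -
  have upd: "vs[i := a] = take i vs @ a # drop (Suc i) vs" if "i < length vs" for i a and vs :: "'a list"
    using that by (simp add: upd_conv_take_nth_drop)
  have sub: "set (take i vs) \<subseteq> V" "set (drop i vs) \<subseteq> V" if "set vs \<subseteq> V" for i vs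
    using that set_take_subset set_drop_subset by fastforce+
  have rep': "\<mu> vs = 0" if "length vs = k" "set vs \<subseteq> V" "i < j" "j < k" "vs ! i = vs ! j" for vs i j
  proof -
    let ?xs = "take i vs" and ?ys = "take (j - Suc i) (drop (Suc i) vs)" and ?zs = "drop (Suc j) vs"
    have "drop (Suc i) vs = ?ys @ drop (j - Suc i) (drop (Suc i) vs)"
      by (rule append_take_drop_id[symmetric])
    also have "drop (j - Suc i) (drop (Suc i) vs) = vs ! j # ?zs"
      using that by (simp add: Cons_nth_drop_Suc)
    finally have vs: "vs = ?xs @ vs ! j # ?ys @ vs ! j # ?zs"
      using that id_take_nth_drop[of i vs] by simp
    have "set (?xs @ ?ys @ ?zs) \<subseteq> V"
      using that by (auto dest!: in_set_takeD in_set_dropD)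
    moreover have "length (?xs @ ?ys @ ?zs) + 2 = k" using that by simp
    moreover have "vs ! j \<in> V" using that by (auto simp: subset_iff)
    ultimately show ?thesis using rep vs by metis
  qed
  show ?thesis
    unfolding alt_maps_def
  proof (intro CollectI conjI allI impI ballI)
    fix vs i j assume "length vs = k \<and> set vs \<subseteq> V" "i < k" "j < k" "i \<noteq> j \<and> vs ! i = vs ! j"
    then show "\<mu> vs = 0" using rep'[of vs i j] rep'[of vs j i] by (metis nat_neq_iff)
  qed (use outside mem add scale upd sub in auto)
qed

lemma alt_maps_swap:
  assumes \<mu>: "\<mu> \<in> alt_maps k V W" and V: "subspace V"
  shows "\<mu> (xs @ a # b # ys) = - \<mu> (xs @ b # a # ys)"
proof (cases "length (xs @ a # b # ys) = k \<and> set (xs @ a # b # ys) \<subseteq> V")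
  case True
  have r: "\<mu> (xs @ c # c # ys) = 0" for c
    using alt_maps_repeated[OF \<mu>, of xs c "[]" ys] by simp
  have "0 = \<mu> (xs @ (a + b) # (a + b) # ys)" using r by simp
  also have "\<dots> = \<mu> (xs @ a # (a + b) # ys) + \<mu> (xs @ b # (a + b) # ys)"
    using alt_maps_add[OF \<mu>, of xs "(a + b) # ys" a b] True subspace_add[OF V] by auto
  also have "\<mu> (xs @ a # (a + b) # ys) = \<mu> (xs @ a # b # ys)"
    using alt_maps_add[OF \<mu>, of "xs @ [a]" ys a b] True r[of a] by auto
  also have "\<mu> (xs @ b # (a + b) # ys) = \<mu> (xs @ b # a # ys)"
    using alt_maps_add[OF \<mu>, of "xs @ [b]" ys a b] True r[of b] by auto
  finally show ?thesis by (simp add: eq_neg_iff_add_eq_0)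
next
  case False
  then have "\<not> (length (xs @ b # a # ys) = k \<and> set (xs @ b # a # ys) \<subseteq> V)" by auto
  from alt_maps_outside[OF \<mu> this] alt_maps_outside[OF \<mu> False] show ?thesis by simp
qed

lemma alt_maps_move:
  assumes \<mu>: "\<mu> \<in> alt_maps k V W" and V: "subspace V"
  shows "\<mu> (xs @ a # ys @ zs) = (-1) ^ length ys *\<^sub>R \<mu> (xs @ ys @ a # zs)"
proof (induction ys arbitrary: xs)
  case (Cons b ys)
  show ?case using Cons[of "xs @ [b]"] alt_maps_swap[OF \<mu> V, of xs a b "ys @ zs"] by simp
qed simp

definition omit :: "nat \<Rightarrow> 'a list \<Rightarrow> 'a list" where
  "omit i vs = take i vs @ drop (Suc i) vs"

text \<open>The wedge product of a 1-form with an alternating map \<open>\<omega>\<close>. The values of the 1-form are linear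
maps \<open>A v\<close> applied to the values of \<open>\<omega>\<close>. Thus one construction covers both \<open>df \<and> \<theta>\<close>,
where \<open>A v\<close> multiplies by \<open>v f\<close>, and \<open>du \<and> \<eta>\<close> for a section \<open>u\<close> and a
scalar form \<open>\<eta>\<close>, where \<open>A \<delta>\<close> sends \<open>c\<close> to \<open>c \<cdot> \<delta>u\<close>.\<close>

definition wedge :: "'v set \<Rightarrow> ('v \<Rightarrow> 'a \<Rightarrow> 'b::real_vector) \<Rightarrow> ('v list \<Rightarrow> 'a) \<Rightarrow> 'v list \<Rightarrow> 'b" where
  "wedge V A \<omega> vs = (if set vs \<subseteq> V then
     \<Sum>i<length vs. (-1) ^ i *\<^sub>R A (vs ! i) (\<omega> (omit i vs)) else 0)"

lemma set_omit: "set (omit i vs) \<subseteq> set vs"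
  by (auto simp: omit_def dest: in_set_takeD in_set_dropD)

lemma length_omit: "i < length vs \<Longrightarrow> length (omit i vs) = length vs - 1"
  by (auto simp: omit_def)

lemma omit_mid [simp]: "omit (length xs) (xs @ a # ys) = xs @ ys"
  by (simp add: omit_def)

lemma omit_left: "i < length xs \<Longrightarrow> omit i (xs @ ys) = omit i xs @ ys"
  by (simp add: omit_def)

lemma omit_right: "omit (length xs + i) (xs @ ys) = xs @ omit i ys"
  by (simp add: omit_def)

lemma wedge_split:
  fixes A :: "'v \<Rightarrow> 'a \<Rightarrow> 'b::real_vector"
  assumes "set (xs @ a # ys) \<subseteq> V"
  shows "wedge V A \<omega> (xs @ a # ys) =
    (\<Sum>i<length xs. (-1) ^ i *\<^sub>R A (xs ! i) (\<omega> (omit i xs @ a # ys)))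
    + (-1) ^ length xs *\<^sub>R A a (\<omega> (xs @ ys))
    + (\<Sum>i<length ys. (-1) ^ (Suc (length xs + i)) *\<^sub>R A (ys ! i) (\<omega> (xs @ a # omit i ys)))"
proof -
  let ?t = "\<lambda>i. (-1) ^ i *\<^sub>R A ((xs @ a # ys) ! i) (\<omega> (omit i (xs @ a # ys)))"
  have "sum g {..<m + Suc n} = sum g {..<m} + g m + (\<Sum>i<n. g (Suc (m + i)))"
    for g :: "nat \<Rightarrow> 'b" and m n
    by (induction n) (simp_all add: add.assoc)
  from this[of ?t "length xs" "length ys"]
  have "sum ?t {..<length (xs @ a # ys)} = sum ?t {..<length xs} + ?t (length xs)
      + (\<Sum>i<length ys. ?t (Suc (length xs + i)))" by simp
  moreover have "omit (Suc (length xs + i)) (xs @ a # ys) = xs @ a # omit i ys" for i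
    using omit_right[of "xs @ [a]" i ys] by simp
  ultimately show ?thesis
    using assms by (simp add: wedge_def nth_append omit_left)
qed

text \<open>All evaluations of wedge products below are of this kind: the first argument is chosen such that only
the term extracting it survives.\<close>

lemma wedge_Cons:
  assumes "set (v # vs) \<subseteq> V" "\<And>i. i < length vs \<Longrightarrow> A (vs ! i) (\<omega> (v # omit i vs)) = 0"
  shows "wedge V A \<omega> (v # vs) = A v (\<omega> vs)"
  using wedge_split[of "[]" v vs V A \<omega>] assms by simp

text \<open>For alternation, only the two terms that extract one of the two equal arguments survive. Moving the other
one past the arguments in between makes them cancel.\<close>

lemma wedge_in_alt_maps:
  assumes \<omega>: "\<omega> \<in> alt_maps k V U" and V: "subspace V" and W: "subspace W"
    and mem: "\<And>v u. v \<in> V \<Longrightarrow> u \<in> U \<Longrightarrow> A v u \<in> W"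
    and lin: "\<And>v. v \<in> V \<Longrightarrow> linear (A v)"
    and add: "\<And>a b u. a \<in> V \<Longrightarrow> b \<in> V \<Longrightarrow> u \<in> U \<Longrightarrow> A (a + b) u = A a u + A b u"
    and scale: "\<And>a c u. a \<in> V \<Longrightarrow> u \<in> U \<Longrightarrow> A (c *\<^sub>R a) u = c *\<^sub>R A a u"
  shows "wedge V A \<omega> \<in> alt_maps (Suc k) V W"
proof (rule alt_mapsI)
  fix vs assume vs: "length vs = Suc k" "set vs \<subseteq> V"
  have "A (vs ! i) (\<omega> (omit i vs)) \<in> W" if "i < length vs" for i
    using that vs set_omit[of i vs]
    by (intro mem alt_maps_mem[OF \<omega>]) (auto simp: length_omit subset_iff)
  then show "wedge V A \<omega> vs \<in> W"
    using vs(2) by (simp only: wedge_def if_True) (intro subspace_sum[OF W] subspace_scale[OF W], simp)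
next
  fix xs ys a b
  assume *: "length (xs @ ys) + 1 = Suc k" "set xs \<subseteq> V" "set ys \<subseteq> V" "a \<in> V" "b \<in> V"
  have U: "\<omega> (xs @ ys) \<in> U" using * by (intro alt_maps_mem[OF \<omega>]) auto
  have "\<omega> (omit i xs @ (a + b) # ys) = \<omega> (omit i xs @ a # ys) + \<omega> (omit i xs @ b # ys)"
    if "i < length xs" for i
    using * that set_omit[of i xs] by (intro alt_maps_add[OF \<omega>]) (auto simp: length_omit)
  moreover have "\<omega> (xs @ (a + b) # omit i ys) = \<omega> (xs @ a # omit i ys) + \<omega> (xs @ b # omit i ys)"
    if "i < length ys" for i
    using * that set_omit[of i ys] by (intro alt_maps_add[OF \<omega>]) (auto simp: length_omit)
  ultimately show "wedge V A \<omega> (xs @ (a + b) # ys) = wedge V A \<omega> (xs @ a # ys) + wedge V A \<omega> (xs @ b # ys)"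
    using * U subspace_add[OF V] nth_mem[of _ xs] nth_mem[of _ ys]
    by (simp add: wedge_split add linear_add[OF lin] subset_iff scaleR_add_right sum.distrib sum_negf sum_subtractf)
next
  fix xs ys a c
  assume *: "length (xs @ ys) + 1 = Suc k" "set xs \<subseteq> V" "set ys \<subseteq> V" "a \<in> V"
  have U: "\<omega> (xs @ ys) \<in> U" using * by (intro alt_maps_mem[OF \<omega>]) auto
  have "\<omega> (omit i xs @ (c *\<^sub>R a) # ys) = c *\<^sub>R \<omega> (omit i xs @ a # ys)" if "i < length xs" for i
    using * that set_omit[of i xs] by (intro alt_maps_scaleR[OF \<omega>]) (auto simp: length_omit)
  moreover have "\<omega> (xs @ (c *\<^sub>R a) # omit i ys) = c *\<^sub>R \<omega> (xs @ a # omit i ys)" if "i < length ys" for i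
    using * that set_omit[of i ys] by (intro alt_maps_scaleR[OF \<omega>]) (auto simp: length_omit)
  ultimately show "wedge V A \<omega> (xs @ (c *\<^sub>R a) # ys) = c *\<^sub>R wedge V A \<omega> (xs @ a # ys)"
    using * U subspace_scale[OF V] nth_mem[of _ xs] nth_mem[of _ ys]
    by (simp add: wedge_split scale linear_scale[OF lin] subset_iff scaleR_add_right scaleR_sum_right
        mult.commute)
next
  fix xs ys zs a
  assume *: "length (xs @ ys @ zs) + 2 = Suc k" "set (xs @ ys @ zs) \<subseteq> V" "a \<in> V"
  have z0: "A v 0 = 0" if "v \<in> V" for v using linear_0[OF lin[OF that]] .
  have l: "\<omega> (omit i xs @ a # ys @ a # zs) = 0" for i by (rule alt_maps_repeated[OF \<omega>])
  have r: "\<omega> (xs @ a # omit i (ys @ a # zs)) = 0" if "i < length (ys @ a # zs)" "i \<noteq> length ys" for i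
  proof (cases "i < length ys")
    case True
    then show ?thesis using alt_maps_repeated[OF \<omega>] by (simp add: omit_left)
  next
    case False
    define j where "j = i - length (ys @ [a])"
    have "i = length (ys @ [a]) + j" using that(2) False by (simp add: j_def)
    then have "omit i (ys @ a # zs) = ys @ a # omit j zs" using omit_right[of "ys @ [a]" j zs] by simp
    then show ?thesis using alt_maps_repeated[OF \<omega>, of xs a ys] by simp
  qed
  have "(\<Sum>i<length xs. (-1) ^ i *\<^sub>R A (xs ! i) (\<omega> (omit i xs @ a # ys @ a # zs))) = 0"
    using * by (intro sum.neutral) (auto simp: l z0 subset_iff)
  moreover have "(\<Sum>i<length (ys @ a # zs). (-1) ^ (Suc (length xs + i)) *\<^sub>R
      A ((ys @ a # zs) ! i) (\<omega> (xs @ a # omit i (ys @ a # zs))))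
    = (\<Sum>i\<in>{length ys}. (-1) ^ (Suc (length xs + i)) *\<^sub>R
      A ((ys @ a # zs) ! i) (\<omega> (xs @ a # omit i (ys @ a # zs))))"
  proof (rule sum.mono_neutral_right)
    show "\<forall>i\<in>{..<length (ys @ a # zs)} - {length ys}. (-1) ^ (Suc (length xs + i)) *\<^sub>R
      A ((ys @ a # zs) ! i) (\<omega> (xs @ a # omit i (ys @ a # zs))) = 0"
    proof
      fix i assume i: "i \<in> {..<length (ys @ a # zs)} - {length ys}"
      then have "(ys @ a # zs) ! i \<in> set (ys @ a # zs)" by (intro nth_mem) simp
      with * have "(ys @ a # zs) ! i \<in> V" by auto
      with r i z0 show "(-1) ^ (Suc (length xs + i)) *\<^sub>R
        A ((ys @ a # zs) ! i) (\<omega> (xs @ a # omit i (ys @ a # zs))) = 0" by simp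
    qed
  qed auto
  moreover have "(\<Sum>i\<in>{length ys}. (-1) ^ (Suc (length xs + i)) *\<^sub>R
      A ((ys @ a # zs) ! i) (\<omega> (xs @ a # omit i (ys @ a # zs))))
    = - ((-1) ^ length xs *\<^sub>R A a (\<omega> (xs @ ys @ a # zs)))"
  proof -
    have "A a (\<omega> (xs @ a # ys @ zs)) = (-1) ^ length ys *\<^sub>R A a (\<omega> (xs @ ys @ a # zs))"
      by (simp add: alt_maps_move[OF \<omega> V, of xs a ys zs] linear_scale[OF lin[OF *(3)]])
    then show ?thesis by (simp add: power_add)
  qed
  moreover have "set (xs @ a # ys @ a # zs) \<subseteq> V" using * by simp
  ultimately show "wedge V A \<omega> (xs @ a # ys @ a # zs) = 0"
    by (simp only: wedge_split) simp
next
  fix vs assume *: "\<not> (length vs = Suc k \<and> set vs \<subseteq> V)"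
  have "A (vs ! i) (\<omega> (omit i vs)) = 0" if "set vs \<subseteq> V" "i < length vs" for i
  proof -
    have "\<omega> (omit i vs) = 0"
      using * that by (intro alt_maps_outside[OF \<omega>]) (auto simp: length_omit)
    then show ?thesis using linear_0[OF lin[of "vs ! i"]] that by (simp add: subset_iff)
  qed
  then show "wedge V A \<omega> vs = 0" by (simp add: wedge_def)
qed

lemma alt_maps_pullback:
  assumes \<theta>: "\<theta> \<in> alt_maps k T UNIV" and V: "subspace V"
    and s: "\<And>v. v \<in> V \<Longrightarrow> s v \<in> T" "\<And>a b. a \<in> V \<Longrightarrow> b \<in> V \<Longrightarrow> s (a + b) = s a + s b"
      "\<And>a c. a \<in> V \<Longrightarrow> s (c *\<^sub>R a) = c *\<^sub>R s a"
    and W: "subspace W" "e \<in> W"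
  shows "(\<lambda>vs. if set vs \<subseteq> V then \<theta> (map s vs) *\<^sub>R e else 0) \<in> alt_maps k V W"
proof (rule alt_mapsI)
  fix xs ys a b
  assume *: "length (xs @ ys) + 1 = k" "set xs \<subseteq> V" "set ys \<subseteq> V" "a \<in> V" "b \<in> V"
  then have "\<theta> (map s xs @ (s a + s b) # map s ys)
      = \<theta> (map s xs @ s a # map s ys) + \<theta> (map s xs @ s b # map s ys)"
    by (intro alt_maps_add[OF \<theta>]) (auto simp: s)
  with * show "(if set (xs @ (a + b) # ys) \<subseteq> V then \<theta> (map s (xs @ (a + b) # ys)) *\<^sub>R e else 0) =
      (if set (xs @ a # ys) \<subseteq> V then \<theta> (map s (xs @ a # ys)) *\<^sub>R e else 0) +
      (if set (xs @ b # ys) \<subseteq> V then \<theta> (map s (xs @ b # ys)) *\<^sub>R e else 0)"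
    using subspace_add[OF V, of a b] by (simp add: s scaleR_add_left)
next
  fix xs ys a c
  assume *: "length (xs @ ys) + 1 = k" "set xs \<subseteq> V" "set ys \<subseteq> V" "a \<in> V"
  then have "\<theta> (map s xs @ (c *\<^sub>R s a) # map s ys) = c *\<^sub>R \<theta> (map s xs @ s a # map s ys)"
    by (intro alt_maps_scaleR[OF \<theta>]) (auto simp: s)
  with * show "(if set (xs @ (c *\<^sub>R a) # ys) \<subseteq> V then \<theta> (map s (xs @ (c *\<^sub>R a) # ys)) *\<^sub>R e else 0) =
      c *\<^sub>R (if set (xs @ a # ys) \<subseteq> V then \<theta> (map s (xs @ a # ys)) *\<^sub>R e else 0)"
    using subspace_scale[OF V, of a c] by (simp add: s)
qed (use alt_maps_repeated[OF \<theta>] alt_maps_outside[OF \<theta>] W in \<open>auto intro: subspace_scale subspace_0\<close>)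

section \<open>Triangular systems\<close>

text \<open>A lower bound on the dimension that stays meaningful for spaces not known to be finite-dimensional,
and that passes to kernels of functionals with a loss of one.\<close>

definition dim_at_least :: "nat \<Rightarrow> 'v::real_vector set \<Rightarrow> bool" where
  "dim_at_least k V \<longleftrightarrow> (\<forall>S. finite S \<and> card S < k \<longrightarrow> \<not> V \<subseteq> span S)"

lemma dim_at_least_mono: "dim_at_least k V \<Longrightarrow> j \<le> k \<Longrightarrow> dim_at_least j V"
  by (auto simp: dim_at_least_def)

lemma dim_at_least_kernel:
  assumes V: "subspace V" and d: "dim_at_least (Suc k) V"
    and add: "\<And>a b. a \<in> V \<Longrightarrow> b \<in> V \<Longrightarrow> f (a + b) = f a + f b"
    and scale: "\<And>a c. a \<in> V \<Longrightarrow> f (c *\<^sub>R a) = c * f a"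
  shows "dim_at_least k {v \<in> V. f v = (0::real)}"
  unfolding dim_at_least_def
proof (intro allI impI notI)
  fix S assume S: "finite S \<and> card S < k" and sub: "{v \<in> V. f v = 0} \<subseteq> span S"
  show False
  proof (cases "\<exists>v\<in>V. f v \<noteq> 0")
    case True
    then obtain v where v: "v \<in> V" "f v \<noteq> 0" by blast
    have "w \<in> span (insert v S)" if w: "w \<in> V" for w
    proof -
      let ?c = "f w / f v"
      have c: "(- ?c) *\<^sub>R v \<in> V" using subspace_scale[OF V v(1)] .
      have "f (w + (- ?c) *\<^sub>R v) = 0" using add[OF w c] scale[OF v(1), of "- ?c"] v by simp
      then have "w + (- ?c) *\<^sub>R v \<in> {v \<in> V. f v = 0}" using subspace_add[OF V w c] by blast
      then have "w + (- ?c) *\<^sub>R v \<in> span S" using sub by blast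
      then show ?thesis unfolding span_insert by auto
    qed
    moreover have "card (insert v S) < Suc k" using S card_insert_le_m1[of "Suc k" S v]
      by (metis card_insert_if less_Suc_eq not_less_eq)
    ultimately show False using d S unfolding dim_at_least_def by (meson finite_insert subsetI)
  next
    case False
    with sub have "V \<subseteq> span S" by auto
    with d S show False unfolding dim_at_least_def by auto
  qed
qed

lemma dim_at_least_nonzero:
  assumes "dim_at_least k V" "k > 0"
  obtains v where "v \<in> V" "v \<noteq> 0"
proof -
  have "\<not> V \<subseteq> span {}" using assms unfolding dim_at_least_def by (metis card.empty finite.emptyI)
  then show thesis using that by auto
qed

lemma subspace_annihilator:
  fixes V :: "('g \<Rightarrow> real) set"
  shows "subspace V \<Longrightarrow> subspace {v \<in> V. \<forall>f\<in>F. v f = 0}"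
  by (auto simp: subspace_def scaleR_fun_def)

text \<open>The matrix of the values of the vectors on the test points is triangular, with nonzero diagonal. Such
systems can be built greedily inside iterated kernels, and they still certify that the wedge product of
the differentials of the test points is nonzero on the vectors.\<close>

fun triangular :: "'g list \<Rightarrow> ('g \<Rightarrow> real) list \<Rightarrow> bool" where
  "triangular [] [] \<longleftrightarrow> True"
| "triangular (f # fs) (v # vs) \<longleftrightarrow> v f \<noteq> 0 \<and> (\<forall>w\<in>set vs. w f = 0) \<and> triangular fs vs"
| "triangular _ _ \<longleftrightarrow> False"

lemma triangular_length: "triangular fs vs \<Longrightarrow> length fs = length vs"
  by (induction fs vs rule: triangular.induct) auto

lemma triangular_snoc:
  "triangular fs vs \<Longrightarrow> \<forall>f\<in>set fs. w f = 0 \<Longrightarrow> w h \<noteq> 0 \<Longrightarrow> triangular (fs @ [h]) (vs @ [w])"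
  by (induction fs vs rule: triangular.induct) auto

text \<open>Choose a nonzero vector and a test point on which it does not vanish, and continue in the kernel of
that test point. The kernel of all chosen test points keeps the remaining dimension, so that the system
can be continued under further constraints.\<close>

lemma triangular_exists:
  fixes V :: "('g \<Rightarrow> real) set"
  assumes "subspace V" "dim_at_least (k + m) V"
  obtains fs vs where "length vs = k" "set vs \<subseteq> V" "triangular fs vs"
    "dim_at_least m {v \<in> V. \<forall>f\<in>set fs. v f = 0}"
proof -
  have "\<exists>fs vs. length vs = k \<and> set vs \<subseteq> V \<and> triangular fs vs \<and>
      dim_at_least m {v \<in> V. \<forall>f\<in>set fs. v f = 0}"
    using assms
  proof (induction k arbitrary: V)
    case 0
    then show ?case by (intro exI[of _ "[]"]) simp
  next
    case (Suc k)
    have "0 < Suc k + m" by simp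
    then obtain v where v: "v \<in> V" "v \<noteq> 0" by (rule dim_at_least_nonzero[OF Suc.prems(2)])
    then obtain f where f: "v f \<noteq> 0" by (auto simp: fun_eq_iff)
    let ?V = "{v \<in> V. v f = 0}"
    have "dim_at_least (k + m) ?V"
      by (rule dim_at_least_kernel) (use Suc.prems in \<open>auto simp: scaleR_fun_def\<close>)
    moreover have "subspace ?V" using subspace_annihilator[OF Suc.prems(1), of "{f}"] by simp
    ultimately have "\<exists>fs vs. length vs = k \<and> set vs \<subseteq> ?V \<and> triangular fs vs \<and>
        dim_at_least m {v \<in> ?V. \<forall>f\<in>set fs. v f = 0}" by (intro Suc.IH)
    then obtain fs vs where *: "length vs = k" "set vs \<subseteq> ?V" "triangular fs vs"
      "dim_at_least m {v \<in> ?V. \<forall>f\<in>set fs. v f = 0}"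
      by (elim exE conjE) (rule that)
    have "{v \<in> ?V. \<forall>f\<in>set fs. v f = 0} = {v \<in> V. \<forall>f\<in>set (f # fs). v f = 0}" by auto
    with *(4) have "dim_at_least m {v \<in> V. \<forall>f\<in>set (f # fs). v f = 0}" by (simp only:)
    moreover have "length (v # vs) = Suc k" "set (v # vs) \<subseteq> V" "triangular (f # fs) (v # vs)"
      using *(1-3) v f by auto
    ultimately show ?case
      by (intro exI[of _ "f # fs"] exI[of _ "v # vs"] conjI)
  qed
  then show thesis by (elim exE conjE) (rule that)
qed

text \<open>The form \<open>df\<^sub>1 \<and> \<dots> \<and> df\<^sub>k\<close>, where \<open>df\<close> is evaluation at \<open>f\<close>.\<close>

fun diff_wedge :: "('g \<Rightarrow> real) set \<Rightarrow> 'g list \<Rightarrow> ('g \<Rightarrow> real) list \<Rightarrow> real" where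
  "diff_wedge T [] vs = (if vs = [] then 1 else 0)"
| "diff_wedge T (f # fs) vs = wedge T (\<lambda>v c. v f * c) (diff_wedge T fs) vs"

lemma diff_wedge_in_alt_maps:
  assumes "subspace T" shows "diff_wedge T fs \<in> alt_maps (length fs) T UNIV"
proof (induction fs)
  case Nil
  show ?case by (rule alt_mapsI) auto
next
  case (Cons f fs)
  have "wedge T (\<lambda>v c. v f * c) (diff_wedge T fs) \<in> alt_maps (Suc (length fs)) T UNIV"
    by (rule wedge_in_alt_maps[OF Cons assms]) (simp_all add: distrib_right scaleR_fun_def)
  moreover have "diff_wedge T (f # fs) = wedge T (\<lambda>v c. v f * c) (diff_wedge T fs)"
    by (rule ext) (rule diff_wedge.simps)
  ultimately show ?case by (simp only: length_Cons)
qed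

lemma diff_wedge_triangular:
  "triangular fs vs \<Longrightarrow> set vs \<subseteq> T \<Longrightarrow> diff_wedge T fs vs \<noteq> 0"
proof (induction fs vs rule: triangular.induct)
  case (2 f fs v vs)
  have "wedge T (\<lambda>v c. v f * c) (diff_wedge T fs) (v # vs) = v f * diff_wedge T fs vs"
    using 2 by (intro wedge_Cons) auto
  with 2 show ?case by simp
qed auto

text \<open>One dimension more than the length of the system suffices to satisfy the additional equation
\<open>\<eta> vs = 0\<close>: the last vector is left open within a space of dimension two, where
\<open>\<eta>\<close> is a linear functional of it.\<close>

lemma triangular_in_kernel:
  fixes V :: "('g \<Rightarrow> real) set"
  assumes "subspace V" "dim_at_least (Suc k) V" "k > 0" "V \<subseteq> T"
    and \<eta>: "\<eta> \<in> alt_maps k T (UNIV :: real set)"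
  obtains fs vs where "length vs = k" "set vs \<subseteq> V" "triangular fs vs" "\<eta> vs = 0"
proof -
  have d: "dim_at_least (k - 1 + 2) V" using assms(2,3) by simp
  obtain fs vs where *: "length vs = k - 1" "set vs \<subseteq> V" "triangular fs vs"
    "dim_at_least 2 {v \<in> V. \<forall>f\<in>set fs. v f = 0}" (is "dim_at_least _ ?K")
    by (rule triangular_exists[OF assms(1) d])
  have "dim_at_least 1 {v \<in> ?K. \<eta> (vs @ [v]) = 0}"
  proof (rule dim_at_least_kernel)
    show "subspace ?K" by (rule subspace_annihilator[OF assms(1)])
    show "dim_at_least (Suc 1) ?K" using *(4) by (simp add: numeral_2_eq_2)
    show "\<eta> (vs @ [a + b]) = \<eta> (vs @ [a]) + \<eta> (vs @ [b])" if "a \<in> ?K" "b \<in> ?K" for a b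
      using that *(1,2) assms(3,4) by (intro alt_maps_add[OF \<eta>]) auto
    show "\<eta> (vs @ [c *\<^sub>R a]) = c * \<eta> (vs @ [a])" if "a \<in> ?K" for a c
      using that *(1,2) assms(3,4) alt_maps_scaleR[OF \<eta>, of vs "[]" a c] by auto
  qed
  then obtain w where "w \<in> {v \<in> ?K. \<eta> (vs @ [v]) = 0}" and w0: "w \<noteq> 0"
    by (rule dim_at_least_nonzero) simp
  then have w: "w \<in> ?K" "\<eta> (vs @ [w]) = 0" by auto
  from w0 obtain h where h: "w h \<noteq> 0" by (auto simp: fun_eq_iff)
  show thesis
  proof (rule that)
    show "length (vs @ [w]) = k" using *(1) assms(3) by simp
    show "set (vs @ [w]) \<subseteq> V" using *(2) w(1) by simp
    show "triangular (fs @ [h]) (vs @ [w])" using w(1) h by (intro triangular_snoc *(3)) auto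
    show "\<eta> (vs @ [w]) = 0" by (rule w(2))
  qed
qed

section \<open>Smooth maps on manifolds\<close>

lemma smooth_on_cong:
  "open S \<Longrightarrow> smooth_on S f \<Longrightarrow> (\<And>y. y \<in> S \<Longrightarrow> f y = g y) \<Longrightarrow> smooth_on S g"
  using times_differentiable_on_cong unfolding smooth_on_def by blast

lemma smooth_on_Un:
  assumes "open S" "open T" "smooth_on S f" "smooth_on T f"
  shows "smooth_on (S \<union> T) f"
  using times_differentiable_on_Union[of "{S, T}" _ f] assms by (auto simp: smooth_on_def)

lemma smooth_map_on_iff:
  "smooth_map_on A W f \<longleftrightarrow> (\<forall>U \<phi> k. (U, \<phi>) \<in> A \<longrightarrow>
     times_differentiable_on k (\<phi> ` (U \<inter> W)) (\<lambda>z. f (inv_into U \<phi> z)))"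
  by (auto simp: smooth_map_on_def smooth_on_def comp_def)

lemma smooth_map_on_subset:
  assumes "smooth_map_on A W f" "V \<subseteq> W"
  shows "smooth_map_on A V f"
  using assms(1) times_differentiable_on_subset image_mono[OF Int_mono[OF order_refl assms(2)]]
  unfolding smooth_map_on_iff by metis

lemma smooth_map_on_const: "smooth_map_on A W (\<lambda>x. c)"
  by (auto simp: smooth_map_on_def smooth_on_def comp_def times_differentiable_on_const)

context
  fixes A :: "('p::{t2_space,second_countable_topology} set \<times> ('p \<Rightarrow> 'm::euclidean_space)) set"
  assumes A: "smooth_manifold A"
begin

lemma chart_homeomorphism:
  "(U, \<phi>) \<in> A \<Longrightarrow> open U \<and> open (\<phi> ` U) \<and> homeomorphism U (\<phi> ` U) \<phi> (inv_into U \<phi>)"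
  using A by (auto simp: smooth_manifold_def)

lemma chart_inverse: "(U, \<phi>) \<in> A \<Longrightarrow> x \<in> U \<Longrightarrow> inv_into U \<phi> (\<phi> x) = x"
  using chart_homeomorphism by (auto simp: homeomorphism_def)

lemma chart_exists: obtains U \<phi> where "(U, \<phi>) \<in> A" "x \<in> U"
proof -
  have "x \<in> (\<Union>(U, \<phi>)\<in>A. U)" using A by (simp add: smooth_manifold_def)
  then show thesis using that by auto
qed

lemma open_chart_image:
  assumes "(U, \<phi>) \<in> A" "open W"
  shows "open (\<phi> ` (U \<inter> W))"
proof -
  have U: "open U" "open (\<phi> ` U)" "homeomorphism U (\<phi> ` U) \<phi> (inv_into U \<phi>)"
    using chart_homeomorphism[OF assms(1)] by auto
  have "openin (top_of_set U) (U \<inter> W)" using assms(2) by (auto simp: openin_open)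
  then have "openin (top_of_set (\<phi> ` U)) (\<phi> ` (U \<inter> W))"
    by (rule homeomorphism_imp_open_map[OF U(3)])
  then show ?thesis using U(2) by (rule openin_open_trans)
qed

lemma smooth_map_on_cong:
  assumes "open W" "smooth_map_on A W f" "\<And>y. y \<in> W \<Longrightarrow> f y = g y"
  shows "smooth_map_on A W g"
proof -
  have "smooth_on (\<phi> ` (U \<inter> W)) (g \<circ> inv_into U \<phi>)" if U: "(U, \<phi>) \<in> A" for U \<phi>
  proof (rule smooth_on_cong[OF open_chart_image[OF U assms(1)]])
    show "smooth_on (\<phi> ` (U \<inter> W)) (f \<circ> inv_into U \<phi>)"
      using assms(2) U by (auto simp: smooth_map_on_def)
    show "(f \<circ> inv_into U \<phi>) y = (g \<circ> inv_into U \<phi>) y" if "y \<in> \<phi> ` (U \<inter> W)" for y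
      using that assms(3) chart_inverse[OF U] by auto
  qed
  then show ?thesis by (auto simp: smooth_map_on_def)
qed

lemma smooth_map_on_Un:
  assumes "open V" "open W" "smooth_map_on A V f" "smooth_map_on A W f"
  shows "smooth_map_on A (V \<union> W) f"
proof -
  have "smooth_on (\<phi> ` (U \<inter> (V \<union> W))) (f \<circ> inv_into U \<phi>)" if U: "(U, \<phi>) \<in> A" for U \<phi>
  proof -
    have "smooth_on (\<phi> ` (U \<inter> V) \<union> \<phi> ` (U \<inter> W)) (f \<circ> inv_into U \<phi>)"
      using assms U by (intro smooth_on_Un open_chart_image) (auto simp: smooth_map_on_def)
    then show ?thesis by (simp add: Int_Un_distrib image_Un)
  qed
  then show ?thesis by (auto simp: smooth_map_on_def)
qed

lemma smooth_map_on_add: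
  assumes "open W" "smooth_map_on A W f" "smooth_map_on A W g"
  shows "smooth_map_on A W (\<lambda>x. f x + g x)"
  using assms times_differentiable_on_add[OF open_chart_image] unfolding smooth_map_on_iff by blast

lemma smooth_map_on_bilinear:
  assumes "bounded_bilinear B" "open W" "smooth_map_on A W f" "smooth_map_on A W g"
  shows "smooth_map_on A W (\<lambda>x. B (f x) (g x))"
  using assms times_differentiable_on_bilinear[OF assms(1) open_chart_image]
  unfolding smooth_map_on_iff by blast

lemmas smooth_map_on_scaleR = smooth_map_on_bilinear[OF bounded_bilinear_scaleR]
lemmas smooth_map_on_inner = smooth_map_on_bilinear[OF bounded_bilinear_inner]

lemma smooth_map_on_compose_real:
  assumes "smooth_on UNIV (h :: real \<Rightarrow> real)" "open W" "smooth_map_on A W f"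
  shows "smooth_map_on A W (\<lambda>x. h (f x))"
  using assms times_differentiable_on_compose_real[OF open_chart_image]
  unfolding smooth_map_on_iff smooth_on_def by blast

lemma smooth_map_on_chart:
  assumes "(U, \<phi>) \<in> A"
  shows "smooth_map_on A U \<phi>"
  using A assms by (fastforce simp: smooth_manifold_def smooth_map_on_def Int_commute)

text \<open>The extension is smooth on two open sets that cover \<open>W\<close>: on \<open>W \<inter> U\<close> it is a product, and on
the complement of \<open>K\<close> it vanishes.\<close>

lemma smooth_map_on_extend_zero:
  assumes W: "open W" "open U" and K: "closed K" "K \<subseteq> U"
    and \<rho>: "smooth_map_on A W \<rho>" "\<And>y. y \<notin> K \<Longrightarrow> \<rho> y = (0::real)"
    and g: "smooth_map_on A (W \<inter> U) g"
  shows "smooth_map_on A W (\<lambda>y. if y \<in> U then \<rho> y *\<^sub>R g y else 0)"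
proof -
  have 1: "open (W \<inter> U)" and 2: "open (W - K)" using W K by auto
  have "smooth_map_on A (W \<inter> U) (\<lambda>y. if y \<in> U then \<rho> y *\<^sub>R g y else 0)"
    by (rule smooth_map_on_cong[OF 1 smooth_map_on_scaleR[OF 1 smooth_map_on_subset[OF \<rho>(1)] g]]) auto
  moreover have "smooth_map_on A (W - K) (\<lambda>y. if y \<in> U then \<rho> y *\<^sub>R g y else 0)"
    by (rule smooth_map_on_cong[OF 2 smooth_map_on_const[of _ _ 0]]) (use \<rho> in auto)
  ultimately have "smooth_map_on A (W \<inter> U \<union> (W - K)) (\<lambda>y. if y \<in> U then \<rho> y *\<^sub>R g y else 0)"
    by (rule smooth_map_on_Un[OF 1 2])
  moreover have "W \<inter> U \<union> (W - K) = W" using K by auto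
  ultimately show ?thesis by simp
qed

text \<open>In a chart, compose the flat function with \<open>\<epsilon>\<^sup>2 - \<bar>z - z\<^sub>0\<bar>\<^sup>2\<close>. The support lies in a
compact ball of the chart, which is closed in the manifold by the Hausdorff property.\<close>

lemma bump_function_exists:
  assumes "open U" "x \<in> U"
  obtains \<rho> K where "\<rho> \<in> smooth_functions A" "closed K" "K \<subseteq> U" "\<And>y. y \<notin> K \<Longrightarrow> \<rho> y = 0" "\<rho> x = 1"
proof -
  obtain V \<phi> where V: "(V, \<phi>) \<in> A" "x \<in> V" by (rule chart_exists)
  have "open (\<phi> ` (V \<inter> U))" by (rule open_chart_image[OF V(1) assms(1)])
  moreover have "\<phi> x \<in> \<phi> ` (V \<inter> U)" using V(2) assms(2) by simp
  ultimately obtain \<epsilon> where \<epsilon>: "\<epsilon> > 0" "cball (\<phi> x) \<epsilon> \<subseteq> \<phi> ` (V \<inter> U)"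
    by (metis open_contains_cball)
  define K where "K = inv_into V \<phi> ` cball (\<phi> x) \<epsilon>"
  have "cball (\<phi> x) \<epsilon> \<subseteq> \<phi> ` V" using \<epsilon>(2) by auto
  moreover have "continuous_on (\<phi> ` V) (inv_into V \<phi>)"
    using chart_homeomorphism[OF V(1)] by (simp add: homeomorphism_def)
  ultimately have "continuous_on (cball (\<phi> x) \<epsilon>) (inv_into V \<phi>)"
    using continuous_on_subset by metis
  then have closed: "closed K" unfolding K_def
    by (intro compact_imp_closed compact_continuous_image) auto
  have sub: "K \<subseteq> V \<inter> U"
  proof
    fix y assume "y \<in> K"
    then obtain z where z: "z \<in> cball (\<phi> x) \<epsilon>" "y = inv_into V \<phi> z" by (auto simp: K_def)
    have "z \<in> \<phi> ` (V \<inter> U)" using \<epsilon>(2) z(1) by (rule subsetD)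
    then obtain y' where "y' \<in> V \<inter> U" "z = \<phi> y'" by (rule imageE) simp
    then show "y \<in> V \<inter> U" using chart_inverse[OF V(1)] z(2) by auto
  qed
  define b where "b y = flat_exp 1 (\<epsilon>\<^sup>2 - (\<phi> y - \<phi> x) \<bullet> (\<phi> y - \<phi> x)) / flat_exp 1 (\<epsilon>\<^sup>2)" for y
  define \<rho> where "\<rho> y = (if y \<in> V then b y else 0)" for y
  have zero: "\<rho> y = 0" if "y \<notin> K" for y
  proof (cases "y \<in> V")
    case True
    have "\<phi> y \<notin> cball (\<phi> x) \<epsilon>"
    proof
      assume "\<phi> y \<in> cball (\<phi> x) \<epsilon>"
      then have "inv_into V \<phi> (\<phi> y) \<in> K" unfolding K_def by (rule imageI)
      then show False using that chart_inverse[OF V(1) True] by simp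
    qed
    then have "\<epsilon> \<le> norm (\<phi> y - \<phi> x)" by (simp add: dist_norm norm_minus_commute)
    then have "\<epsilon>\<^sup>2 \<le> (\<phi> y - \<phi> x) \<bullet> (\<phi> y - \<phi> x)"
      using \<epsilon>(1) by (simp add: power2_norm_eq_inner[symmetric] power_mono)
    then show ?thesis by (simp add: \<rho>_def b_def flat_exp_def)
  qed (simp add: \<rho>_def)
  have V': "open V" using chart_homeomorphism[OF V(1)] by simp
  have sub1: "smooth_map_on A V (\<lambda>y. \<phi> y + - \<phi> x)"
    by (intro smooth_map_on_add V' smooth_map_on_chart[OF V(1)] smooth_map_on_const)
  have "smooth_map_on A V (\<lambda>y. \<epsilon>\<^sup>2 + (-1) *\<^sub>R ((\<phi> y + - \<phi> x) \<bullet> (\<phi> y + - \<phi> x)))"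
    by (rule smooth_map_on_add[OF V' smooth_map_on_const
          smooth_map_on_scaleR[OF V' smooth_map_on_const smooth_map_on_inner[OF V' sub1 sub1]]])
  from smooth_map_on_scaleR[OF V' smooth_map_on_const[of _ _ "inverse (flat_exp 1 (\<epsilon>\<^sup>2))"]
      smooth_map_on_compose_real[OF _ V' this, of "flat_exp 1"]]
  have "smooth_map_on A V (\<lambda>y. inverse (flat_exp 1 (\<epsilon>\<^sup>2)) *
      flat_exp 1 (\<epsilon>\<^sup>2 - (\<phi> y - \<phi> x) \<bullet> (\<phi> y - \<phi> x)))"
    by (simp add: smooth_on_def times_differentiable_flat_exp)
  moreover have "b = (\<lambda>y. inverse (flat_exp 1 (\<epsilon>\<^sup>2)) *
      flat_exp 1 (\<epsilon>\<^sup>2 - (\<phi> y - \<phi> x) \<bullet> (\<phi> y - \<phi> x)))"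
    by (rule ext) (simp add: b_def divide_inverse mult.commute)
  ultimately have "smooth_map_on A V b" by simp
  then have "smooth_map_on A V \<rho>" by (rule smooth_map_on_cong[OF V']) (simp add: \<rho>_def)
  moreover have "smooth_map_on A (- K) \<rho>"
    by (rule smooth_map_on_cong[OF _ smooth_map_on_const[of _ _ 0]]) (use closed zero in auto)
  ultimately have "smooth_map_on A (V \<union> - K) \<rho>"
    using V' closed by (intro smooth_map_on_Un) auto
  moreover have "V \<union> - K = UNIV" using sub by auto
  ultimately have "\<rho> \<in> smooth_functions A" by (simp add: smooth_functions_def)
  moreover have "\<rho> x = 1" using V(2) \<epsilon>(1) by (simp add: \<rho>_def b_def flat_exp_def)
  ultimately show thesis using that[of \<rho> K] closed sub zero by auto
qed

lemma smooth_function_differentiable: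
  assumes "f \<in> smooth_functions A" "(U, \<phi>) \<in> A" "x \<in> U"
  shows "(f \<circ> inv_into U \<phi>) differentiable (at (\<phi> x))"
proof -
  have "times_differentiable_on (Suc 0) (\<phi> ` U) (f \<circ> inv_into U \<phi>)"
  proof -
    have "smooth_map_on A UNIV f" using assms(1) by (simp add: smooth_functions_def)
    then have "times_differentiable_on (Suc 0) (\<phi> ` (U \<inter> UNIV)) (\<lambda>z. f (inv_into U \<phi> z))"
      using assms(2) unfolding smooth_map_on_iff by blast
    then show ?thesis by (simp only: Int_UNIV_right comp_def)
  qed
  with assms(3) show ?thesis by simp
qed

lemma smooth_functions_closed:
  assumes "f \<in> smooth_functions A" "g \<in> smooth_functions A"
  shows "f + g \<in> smooth_functions A" "f * g \<in> smooth_functions A" "c *\<^sub>R f \<in> smooth_functions A"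
  using smooth_map_on_add[OF open_UNIV, of f g] smooth_map_on_scaleR[OF open_UNIV, of f g]
    smooth_map_on_scaleR[OF open_UNIV smooth_map_on_const, of f c] assms
  by (simp_all add: smooth_functions_def plus_fun_def times_fun_def scaleR_fun_def)

lemma subspace_tangent_space: "subspace (tangent_space A x)"
  unfolding subspace_def
proof (intro conjI ballI allI)
  show "0 \<in> tangent_space A x" by (simp add: tangent_space_def)
  show "v + w \<in> tangent_space A x" if "v \<in> tangent_space A x" "w \<in> tangent_space A x" for v w
    using that by (simp add: tangent_space_def distrib_left distrib_right)
  show "c *\<^sub>R v \<in> tangent_space A x" if "v \<in> tangent_space A x" for c v
    using that by (simp add: tangent_space_def scaleR_fun_def distrib_left)
qed

text \<open>The vectors \<open>X b\<close> are the partial derivatives in a chart. The functions \<open>y c\<close> are the coordinates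
centred at \<open>x\<close> and cut off by a bump function; since they vanish at \<open>x\<close>, the derivative of the
cutoff does not contribute.\<close>

lemma coordinate_vectors_exist:
  obtains X :: "'m \<Rightarrow> ('p \<Rightarrow> real) \<Rightarrow> real" and y :: "'m \<Rightarrow> 'p \<Rightarrow> real"
  where "\<And>b. b \<in> Basis \<Longrightarrow> X b \<in> tangent_space A x"
    and "\<And>b c. b \<in> Basis \<Longrightarrow> c \<in> Basis \<Longrightarrow> X b (y c) = (if b = c then 1 else 0)"
proof -
  obtain V \<phi> where V: "(V, \<phi>) \<in> A" "x \<in> V" by (rule chart_exists)
  have V': "open V" using chart_homeomorphism[OF V(1)] by simp
  obtain \<rho> K where \<rho>: "\<rho> \<in> smooth_functions A" "closed K" "K \<subseteq> V" "\<And>y. y \<notin> K \<Longrightarrow> \<rho> y = 0" "\<rho> x = 1"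
    by (rule bump_function_exists[OF V' V(2)]) blast
  let ?D = "\<lambda>f. frechet_derivative (f \<circ> inv_into V \<phi>) (at (\<phi> x))"
  define X where "X b f = (if f \<in> smooth_functions A then ?D f b else 0)" for b f
  define y where "y c q = (if q \<in> V then \<rho> q *\<^sub>R ((\<phi> q + - \<phi> x) \<bullet> c) else 0)" for c q
  have D: "(f \<circ> inv_into V \<phi> has_derivative ?D f) (at (\<phi> x))" if "f \<in> smooth_functions A" for f
    using smooth_function_differentiable[OF that V] by (simp add: frechet_derivative_works)
  have at_x: "f (inv_into V \<phi> (\<phi> x)) = f x" for f :: "'p \<Rightarrow> real"
    using chart_inverse[OF V] by simp
  show thesis
  proof (rule that[of X y])
    fix b :: 'm
    have "X b (f + g) = X b f + X b g \<and> X b (f * g) = X b f * g x + f x * X b g"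
      if f: "f \<in> smooth_functions A" and g: "g \<in> smooth_functions A" for f g
    proof
      have "(f + g) \<circ> inv_into V \<phi> = (\<lambda>z. (f \<circ> inv_into V \<phi>) z + (g \<circ> inv_into V \<phi>) z)" by auto
      then have "((f + g) \<circ> inv_into V \<phi> has_derivative (\<lambda>h. ?D f h + ?D g h)) (at (\<phi> x))"
        using has_derivative_add[OF D[OF f] D[OF g]] by simp
      from frechet_derivative_at[OF this] show "X b (f + g) = X b f + X b g"
        using f g smooth_functions_closed by (simp add: X_def fun_eq_iff)
      have "(f * g) \<circ> inv_into V \<phi> = (\<lambda>z. (f \<circ> inv_into V \<phi>) z * (g \<circ> inv_into V \<phi>) z)" by auto
      then have "((f * g) \<circ> inv_into V \<phi> has_derivative (\<lambda>h. ?D f h * g x + f x * ?D g h)) (at (\<phi> x))"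
        using has_derivative_mult[OF D[OF f] D[OF g]] by (simp add: at_x add.commute)
      from frechet_derivative_at[OF this] show "X b (f * g) = X b f * g x + f x * X b g"
        using f g smooth_functions_closed by (simp add: X_def fun_eq_iff)
    qed
    moreover have "X b (c *\<^sub>R f) = c * X b f" if f: "f \<in> smooth_functions A" for f c
    proof -
      have "(c *\<^sub>R f) \<circ> inv_into V \<phi> = (\<lambda>z. c *\<^sub>R (f \<circ> inv_into V \<phi>) z)"
        by (auto simp: scaleR_fun_def)
      then have "((c *\<^sub>R f) \<circ> inv_into V \<phi> has_derivative (\<lambda>h. c *\<^sub>R ?D f h)) (at (\<phi> x))"
        using has_derivative_scaleR_right[OF D[OF f]] by simp
      from frechet_derivative_at[OF this] show ?thesis
        using f smooth_functions_closed by (simp add: X_def fun_eq_iff)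
    qed
    ultimately show "X b \<in> tangent_space A x" by (auto simp: tangent_space_def X_def)
  next
    fix b c :: 'm assume bc: "b \<in> Basis" "c \<in> Basis"
    have "smooth_map_on A V (\<lambda>q. (\<phi> q + - \<phi> x) \<bullet> c)"
      by (intro smooth_map_on_inner smooth_map_on_add V' smooth_map_on_chart[OF V(1)] smooth_map_on_const)
    then have "smooth_map_on A UNIV (\<lambda>q. if q \<in> V then \<rho> q *\<^sub>R ((\<phi> q + - \<phi> x) \<bullet> c) else 0)"
      using \<rho>(1) by (intro smooth_map_on_extend_zero[OF open_UNIV V' \<rho>(2,3) _ \<rho>(4)])
        (simp_all add: smooth_functions_def)
    then have y: "y c \<in> smooth_functions A"
      by (simp add: smooth_functions_def y_def[abs_def])
    have "((\<lambda>z. (z - \<phi> x) \<bullet> c) has_derivative (\<lambda>h. h \<bullet> c)) (at (\<phi> x))"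
      by (auto intro!: derivative_eq_intros)
    from has_derivative_mult[OF D[OF \<rho>(1)] this]
    have "((\<lambda>z. (\<rho> \<circ> inv_into V \<phi>) z * ((z - \<phi> x) \<bullet> c)) has_derivative (\<lambda>h. h \<bullet> c)) (at (\<phi> x))"
      by (simp add: at_x \<rho>(5))
    then have "(y c \<circ> inv_into V \<phi> has_derivative (\<lambda>h. h \<bullet> c)) (at (\<phi> x))"
    proof (rule has_derivative_transform_within_open)
      show "open (\<phi> ` V)" "\<phi> x \<in> \<phi> ` V" using chart_homeomorphism[OF V(1)] V(2) by auto
      show "(\<rho> \<circ> inv_into V \<phi>) z * ((z - \<phi> x) \<bullet> c) = (y c \<circ> inv_into V \<phi>) z" if "z \<in> \<phi> ` V" for z
        using that chart_inverse[OF V(1)] by (auto simp: y_def)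
    qed
    from fun_cong[OF frechet_derivative_at[OF this], of b] show "X b (y c) = (if b = c then 1 else 0)"
      using y bc by (simp add: X_def inner_Basis split: if_splits)
  qed
qed

text \<open>Evaluation on the coordinate functions maps the tangent space onto the model space.\<close>

lemma dim_at_least_tangent_space: "dim_at_least DIM('m) (tangent_space A x)"
  unfolding dim_at_least_def
proof (intro allI impI notI)
  fix S :: "(('p \<Rightarrow> real) \<Rightarrow> real) set"
  assume S: "finite S \<and> card S < DIM('m)" and sub: "tangent_space A x \<subseteq> span S"
  obtain X :: "'m \<Rightarrow> ('p \<Rightarrow> real) \<Rightarrow> real" and y :: "'m \<Rightarrow> 'p \<Rightarrow> real"
    where d: "\<And>b. b \<in> Basis \<Longrightarrow> X b \<in> tangent_space A x"
      "\<And>b c. b \<in> Basis \<Longrightarrow> c \<in> Basis \<Longrightarrow> X b (y c) = (if b = c then 1 else 0)"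
    by (rule coordinate_vectors_exist[of x]) blast
  define ev where "ev w = (\<Sum>c\<in>Basis. w (y c) *\<^sub>R c)" for w :: "('p \<Rightarrow> real) \<Rightarrow> real"
  have lin: "linear ev"
    by (rule linearI) (simp_all add: ev_def scaleR_fun_def scaleR_add_left sum.distrib scaleR_sum_right)
  have "ev (X b) = b" if "b \<in> Basis" for b
  proof -
    have "ev (X b) = (\<Sum>c\<in>Basis. if c = b then c else 0)"
      unfolding ev_def by (rule sum.cong) (auto simp: d(2)[OF that])
    with that show ?thesis by simp
  qed
  then have "(Basis :: 'm set) \<subseteq> ev ` span S" using d(1) sub by (metis image_eqI subset_iff)
  then have "(Basis :: 'm set) \<subseteq> span (ev ` S)" by (simp add: linear_span_image[OF lin])
  then have "DIM('m) \<le> card (ev ` S)"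
    using independent_span_bound[OF _ independent_Basis] S by blast
  then show False using S card_image_le[of S ev] by simp
qed

end

section \<open>Sections and point derivations of a vector bundle\<close>

context
  fixes E :: "('p::{t2_space,second_countable_topology}, 'm::euclidean_space,
      'e::real_vector, 'f::euclidean_space) vbundle"
  assumes E: "vector_bundle E"
begin

lemma smooth_manifold_atlas: "smooth_manifold (atlas E)"
  using E by (simp add: vector_bundle_def)

lemma subspace_fibre: "subspace (fibre E x)"
  using E by (simp add: vector_bundle_def)

lemma trivialisation:
  assumes "(U, \<psi>) \<in> trivs E"
  shows "open U" and "x \<in> U \<Longrightarrow> linear (\<psi> x)" and "x \<in> U \<Longrightarrow> bij_betw (\<psi> x) (fibre E x) UNIV"
  using E assms by (auto simp: vector_bundle_def)

lemma trivialisation_exists: obtains U \<psi> where "(U, \<psi>) \<in> trivs E" "x \<in> U"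
proof -
  have "x \<in> (\<Union>(U, \<psi>)\<in>trivs E. U)" using E by (simp add: vector_bundle_def)
  then show thesis using that by auto
qed

lemma trivialisation_inverse:
  assumes "(U, \<psi>) \<in> trivs E" "x \<in> U"
  shows "\<psi> x (inv_into (fibre E x) (\<psi> x) w) = w" and "inv_into (fibre E x) (\<psi> x) w \<in> fibre E x"
    and "e \<in> fibre E x \<Longrightarrow> inv_into (fibre E x) (\<psi> x) (\<psi> x e) = e"
proof -
  have b: "bij_betw (\<psi> x) (fibre E x) UNIV" by (rule trivialisation(3)[OF assms])
  show "\<psi> x (inv_into (fibre E x) (\<psi> x) w) = w" by (rule bij_betw_inv_into_right[OF b UNIV_I])
  show "inv_into (fibre E x) (\<psi> x) w \<in> fibre E x"
    by (rule bij_betw_apply[OF bij_betw_inv_into[OF b] UNIV_I])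
  show "inv_into (fibre E x) (\<psi> x) (\<psi> x e) = e" if "e \<in> fibre E x"
    by (rule bij_betw_inv_into_left[OF b that])
qed

lemma sections_smooth:
  "u \<in> sections E W \<Longrightarrow> (U, \<psi>) \<in> trivs E \<Longrightarrow> smooth_map_on (atlas E) (U \<inter> W) (\<lambda>y. \<psi> y (u y))"
  by (auto simp: sections_def)

lemma sections_combine:
  assumes u: "u \<in> sections E UNIV" "w \<in> sections E UNIV"
    and f: "f \<in> smooth_functions (atlas E)" "g \<in> smooth_functions (atlas E)"
  shows "(\<lambda>y. f y *\<^sub>R u y + g y *\<^sub>R w y) \<in> sections E UNIV"
  unfolding sections_def
proof (intro CollectI conjI ballI, goal_cases)
  case (1 x)
  then show ?case using u subspace_add[OF subspace_fibre] subspace_scale[OF subspace_fibre]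
    by (simp add: sections_def)
next
  case (2 t)
  obtain U \<psi> where t: "t = (U, \<psi>)" by (cases t)
  with 2 have U: "(U, \<psi>) \<in> trivs E" by simp
  have o: "open (U \<inter> UNIV)" using trivialisation(1)[OF U] by simp
  have fg: "smooth_map_on (atlas E) (U \<inter> UNIV) f" "smooth_map_on (atlas E) (U \<inter> UNIV) g"
    using f smooth_map_on_subset[of "atlas E" UNIV] by (auto simp: smooth_functions_def)
  have "smooth_map_on (atlas E) (U \<inter> UNIV) (\<lambda>y. f y *\<^sub>R \<psi> y (u y) + g y *\<^sub>R \<psi> y (w y))"
    by (intro smooth_map_on_add[OF smooth_manifold_atlas o] fg sections_smooth[OF _ U] u
        smooth_map_on_scaleR[OF smooth_manifold_atlas o])
  then have "smooth_map_on (atlas E) (U \<inter> UNIV) (\<lambda>y. \<psi> y (f y *\<^sub>R u y + g y *\<^sub>R w y))"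
    by (rule smooth_map_on_cong[OF smooth_manifold_atlas o])
      (simp add: linear_add[OF trivialisation(2)[OF U]] linear_scale[OF trivialisation(2)[OF U]])
  then show ?case by (simp add: t)
qed

lemma const_in_smooth_functions: "(\<lambda>y. c) \<in> smooth_functions (atlas E)"
  by (simp add: smooth_functions_def smooth_map_on_const)

lemma sections_add: "u \<in> sections E UNIV \<Longrightarrow> w \<in> sections E UNIV \<Longrightarrow> u + w \<in> sections E UNIV"
  using sections_combine[OF _ _ const_in_smooth_functions[of 1] const_in_smooth_functions[of 1]]
  by (simp add: plus_fun_def)

lemma sections_mult:
  "f \<in> smooth_functions (atlas E) \<Longrightarrow> u \<in> sections E UNIV \<Longrightarrow> (\<lambda>y. f y *\<^sub>R u y) \<in> sections E UNIV"
  using sections_combine[OF _ _ _ const_in_smooth_functions[of 0], of u u f] by simp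

lemma sections_scaleR: "u \<in> sections E UNIV \<Longrightarrow> c *\<^sub>R u \<in> sections E UNIV"
  using sections_mult[OF const_in_smooth_functions] by (simp add: scaleR_fun_def)

lemma section_through:
  assumes e: "e \<in> fibre E x"
  obtains u where "u \<in> sections E UNIV" "u x = e"
proof -
  obtain U \<psi> where U: "(U, \<psi>) \<in> trivs E" "x \<in> U" by (rule trivialisation_exists)
  obtain \<rho> K where \<rho>: "\<rho> \<in> smooth_functions (atlas E)" "closed K" "K \<subseteq> U" "\<And>y. y \<notin> K \<Longrightarrow> \<rho> y = 0" "\<rho> x = 1"
    by (rule bump_function_exists[OF smooth_manifold_atlas trivialisation(1)[OF U(1)] U(2)]) blast
  let ?i = "\<lambda>y. inv_into (fibre E y) (\<psi> y) (\<psi> x e)"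
  let ?u = "\<lambda>y. if y \<in> U then \<rho> y *\<^sub>R ?i y else 0"
  have "?u \<in> sections E UNIV"
    unfolding sections_def
  proof (intro CollectI conjI ballI, goal_cases)
    case (1 y)
    then show ?case
      using trivialisation_inverse(2)[OF U(1)] subspace_scale[OF subspace_fibre] subspace_0[OF subspace_fibre]
      by simp
  next
    case (2 t)
    obtain V \<theta> where t: "t = (V, \<theta>)" by (cases t)
    with 2 have V: "(V, \<theta>) \<in> trivs E" by simp
    note o = trivialisation(1)[OF V]
    have "smooth_map_on (atlas E) V \<rho>"
      using \<rho>(1) smooth_map_on_subset[of "atlas E" UNIV \<rho> V] by (simp add: smooth_functions_def)
    moreover have "smooth_map_on (atlas E) (V \<inter> U) (\<lambda>y. \<theta> y (?i y))"
      using E U(1) V by (fastforce simp: vector_bundle_def Int_commute)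
    ultimately have "smooth_map_on (atlas E) V (\<lambda>y. if y \<in> U then \<rho> y *\<^sub>R \<theta> y (?i y) else 0)"
      by (intro smooth_map_on_extend_zero[OF smooth_manifold_atlas o trivialisation(1)[OF U(1)] \<rho>(2,3) _ \<rho>(4)])
    then have "smooth_map_on (atlas E) V (\<lambda>y. \<theta> y (?u y))"
      by (rule smooth_map_on_cong[OF smooth_manifold_atlas o])
        (simp add: linear_0[OF trivialisation(2)[OF V]] linear_scale[OF trivialisation(2)[OF V]])
    then show ?case by (simp add: t)
  qed
  moreover have "?u x = e" using trivialisation_inverse(3)[OF U e] U(2) \<rho>(5) by simp
  ultimately show thesis by (rule that)
qed

lemma zero_in_sections: "(\<lambda>y. 0) \<in> sections E UNIV"
proof -
  obtain u where "u \<in> sections E UNIV" by (rule section_through[OF subspace_0[OF subspace_fibre]])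
  then show ?thesis using sections_mult[OF const_in_smooth_functions[of 0]] by simp
qed

lemma fibre_nonzero: obtains e where "e \<in> fibre E x" "e \<noteq> 0"
proof -
  obtain U \<psi> where U: "(U, \<psi>) \<in> trivs E" "x \<in> U" by (rule trivialisation_exists)
  obtain w :: 'f where w: "w \<noteq> 0" using nonempty_Basis nonzero_Basis by blast
  let ?e = "inv_into (fibre E x) (\<psi> x) w"
  have "?e \<noteq> 0"
    using trivialisation_inverse(1)[OF U, of w] linear_0[OF trivialisation(2)[OF U]] w by metis
  with trivialisation_inverse(2)[OF U] show thesis by (rule that)
qed

text \<open>Independence is stated in the form in which it separates the two terms of the relation (R).\<close>

lemma fibre_independent:
  assumes "DIM('f) \<ge> 2" "e \<in> fibre E x"
  obtains e' where "e' \<in> fibre E x" "\<And>a b. a *\<^sub>R e' + b *\<^sub>R e = 0 \<Longrightarrow> a = 0"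
proof -
  obtain U \<psi> where U: "(U, \<psi>) \<in> trivs E" "x \<in> U" by (rule trivialisation_exists)
  have "span {\<psi> x e} \<noteq> UNIV"
  proof
    assume "span {\<psi> x e} = UNIV"
    then have "DIM('f) \<le> card {\<psi> x e}" using span_card_ge_dim[of "{\<psi> x e}" UNIV] by simp
    with assms(1) show False by simp
  qed
  then obtain w where w: "w \<notin> span {\<psi> x e}" by blast
  note lin = trivialisation(2)[OF U]
  show thesis
  proof (rule that)
    show "inv_into (fibre E x) (\<psi> x) w \<in> fibre E x" by (rule trivialisation_inverse(2)[OF U])
    fix a b assume "a *\<^sub>R inv_into (fibre E x) (\<psi> x) w + b *\<^sub>R e = 0"
    then have "\<psi> x (a *\<^sub>R inv_into (fibre E x) (\<psi> x) w + b *\<^sub>R e) = 0" by (simp add: linear_0[OF lin])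
    then have *: "a *\<^sub>R w + b *\<^sub>R \<psi> x e = 0"
      by (simp add: linear_add[OF lin] linear_scale[OF lin] trivialisation_inverse(1)[OF U])
    show "a = 0"
    proof (rule ccontr)
      assume a: "a \<noteq> 0"
      have "a *\<^sub>R w = (- b) *\<^sub>R \<psi> x e" using * by (simp add: add_eq_0_iff2)
      then have "w = (- b / a) *\<^sub>R \<psi> x e" using a
        by (metis scaleR_scaleR divide_inverse mult.commute left_inverse scaleR_one)
      then show False using w span_scale[OF span_base, of "\<psi> x e" "{\<psi> x e}" "- b / a"] by simp
    qed
  qed
qed

lemma has_symbol_unique:
  assumes "has_symbol E x \<delta> v" "has_symbol E x \<delta> w"
  shows "v = w"
proof
  fix f
  show "v f = w f"
  proof (cases "f \<in> smooth_functions (atlas E)")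
    case True
    obtain e where e: "e \<in> fibre E x" "e \<noteq> 0" by (rule fibre_nonzero)
    obtain u where u: "u \<in> sections E UNIV" "u x = e" by (rule section_through[OF e(1)])
    have "v f *\<^sub>R u x + f x *\<^sub>R \<delta> u = w f *\<^sub>R u x + f x *\<^sub>R \<delta> u"
      using assms True u(1) unfolding has_symbol_def by metis
    then show ?thesis using u(2) e(2) by simp
  next
    case False
    then show ?thesis using assms by (simp add: has_symbol_def tangent_space_def)
  qed
qed

lemma symbol_eqI: "has_symbol E x \<delta> v \<Longrightarrow> symbol E x \<delta> = v"
  unfolding symbol_def using has_symbol_unique by (intro the_equality)

lemma has_symbol_symbol: "\<delta> \<in> gauge_fibre E x \<Longrightarrow> has_symbol E x \<delta> (symbol E x \<delta>)"
  using symbol_eqI by (fastforce simp: gauge_fibre_def)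

lemma symbol_in_tangent_space: "\<delta> \<in> gauge_fibre E x \<Longrightarrow> symbol E x \<delta> \<in> tangent_space (atlas E) x"
  using has_symbol_symbol by (simp add: has_symbol_def)

lemma subspace_tangent: "subspace (tangent_space (atlas E) x)"
  by (rule subspace_tangent_space[OF smooth_manifold_atlas])

lemma has_symbol_add:
  "has_symbol E x \<delta> v \<Longrightarrow> has_symbol E x \<epsilon> w \<Longrightarrow> has_symbol E x (\<delta> + \<epsilon>) (v + w)"
  using subspace_add[OF subspace_tangent]
  by (simp add: has_symbol_def scaleR_add_left scaleR_add_right)

lemma has_symbol_scaleR: "has_symbol E x \<delta> v \<Longrightarrow> has_symbol E x (c *\<^sub>R \<delta>) (c *\<^sub>R v)"
  using subspace_scale[OF subspace_tangent]
  by (simp add: has_symbol_def scaleR_fun_def scaleR_add_right mult.commute)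

lemma has_symbol_zero: "has_symbol E x 0 0"
  using subspace_0[OF subspace_tangent] by (simp add: has_symbol_def)

lemma gauge_fibreI:
  assumes "\<And>u. u \<in> sections E UNIV \<Longrightarrow> \<delta> u \<in> fibre E x"
    and "\<And>u w. u \<in> sections E UNIV \<Longrightarrow> w \<in> sections E UNIV \<Longrightarrow> \<delta> (u + w) = \<delta> u + \<delta> w"
    and "\<And>u c. u \<in> sections E UNIV \<Longrightarrow> \<delta> (c *\<^sub>R u) = c *\<^sub>R \<delta> u"
    and "has_symbol E x \<delta> v"
    and "\<And>u. u \<notin> sections E UNIV \<Longrightarrow> \<delta> u = 0"
  shows "\<delta> \<in> gauge_fibre E x"
  unfolding gauge_fibre_def
  by (intro CollectI conjI ballI allI impI assms(1,2,3,5) exI[of _ v] assms(4))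

lemma gauge_fibre_outside: "\<delta> \<in> gauge_fibre E x \<Longrightarrow> u \<notin> sections E UNIV \<Longrightarrow> \<delta> u = 0"
  by (simp add: gauge_fibre_def)

lemma gauge_fibre_in_fibre: "\<delta> \<in> gauge_fibre E x \<Longrightarrow> u \<in> sections E UNIV \<Longrightarrow> \<delta> u \<in> fibre E x"
  by (simp add: gauge_fibre_def)

lemma gauge_fibre_scaleR:
  "\<delta> \<in> gauge_fibre E x \<Longrightarrow> u \<in> sections E UNIV \<Longrightarrow> \<delta> (c *\<^sub>R u) = c *\<^sub>R \<delta> u"
  by (simp add: gauge_fibre_def)

lemma subspace_gauge_fibre: "subspace (gauge_fibre E x)"
  unfolding subspace_def
proof (intro conjI ballI allI)
  show "0 \<in> gauge_fibre E x"
    by (rule gauge_fibreI[OF _ _ _ has_symbol_zero]) (simp_all add: subspace_0[OF subspace_fibre])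
  show "\<delta> + \<epsilon> \<in> gauge_fibre E x" if "\<delta> \<in> gauge_fibre E x" "\<epsilon> \<in> gauge_fibre E x" for \<delta> \<epsilon>
    by (rule gauge_fibreI[OF _ _ _ has_symbol_add[OF that[THEN has_symbol_symbol]]])
      (use that in \<open>simp_all add: gauge_fibre_def subspace_add[OF subspace_fibre] scaleR_add_right\<close>)
  show "c *\<^sub>R \<delta> \<in> gauge_fibre E x" if "\<delta> \<in> gauge_fibre E x" for \<delta> c
    by (rule gauge_fibreI[OF _ _ _ has_symbol_scaleR[OF has_symbol_symbol[OF that]]])
      (use that in \<open>simp_all add: gauge_fibre_def scaleR_fun_def subspace_scale[OF subspace_fibre]
        scaleR_add_right mult.commute\<close>)
qed

lemma symbol_add:
  "\<delta> \<in> gauge_fibre E x \<Longrightarrow> \<epsilon> \<in> gauge_fibre E x \<Longrightarrow> symbol E x (\<delta> + \<epsilon>) = symbol E x \<delta> + symbol E x \<epsilon>"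
  by (intro symbol_eqI has_symbol_add has_symbol_symbol)

lemma symbol_scaleR: "\<delta> \<in> gauge_fibre E x \<Longrightarrow> symbol E x (c *\<^sub>R \<delta>) = c *\<^sub>R symbol E x \<delta>"
  by (intro symbol_eqI has_symbol_scaleR has_symbol_symbol)

lemma endo_derivation_properties:
  assumes \<Phi>: "linear \<Phi>" "\<Phi> ` fibre E x \<subseteq> fibre E x"
  shows "endo_derivation E x \<Phi> \<in> gauge_fibre E x" "symbol E x (endo_derivation E x \<Phi>) = 0"
proof -
  have s: "has_symbol E x (endo_derivation E x \<Phi>) 0"
    using subspace_0[OF subspace_tangent] sections_mult
    by (simp add: has_symbol_def endo_derivation_def linear_scale[OF \<Phi>(1)])
  then show "symbol E x (endo_derivation E x \<Phi>) = 0" by (rule symbol_eqI)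
  show "endo_derivation E x \<Phi> \<in> gauge_fibre E x"
  proof (rule gauge_fibreI[OF _ _ _ s])
    fix u assume u: "u \<in> sections E UNIV"
    then have "u x \<in> fibre E x" by (simp add: sections_def)
    then show "endo_derivation E x \<Phi> u \<in> fibre E x" using u \<Phi>(2) by (auto simp: endo_derivation_def)
    show "endo_derivation E x \<Phi> (u + w) = endo_derivation E x \<Phi> u + endo_derivation E x \<Phi> w"
      if "w \<in> sections E UNIV" for w
      using u that sections_add[OF u that] by (simp add: endo_derivation_def linear_add[OF \<Phi>(1)])
    show "endo_derivation E x \<Phi> (c *\<^sub>R u) = c *\<^sub>R endo_derivation E x \<Phi> u" for c
      using u sections_scaleR[OF u] by (simp add: endo_derivation_def scaleR_fun_def linear_scale[OF \<Phi>(1)])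
  qed (simp add: endo_derivation_def)
qed

text \<open>Differentiate the components of a section with respect to a trivialisation, cut off to global
functions: the covariant derivative along \<open>v\<close> for the flat connection of the trivialisation.\<close>

lemma symbol_surjective:
  assumes v: "v \<in> tangent_space (atlas E) x"
  obtains \<delta> where "\<delta> \<in> gauge_fibre E x" "symbol E x \<delta> = v"
proof -
  obtain U \<psi> where U: "(U, \<psi>) \<in> trivs E" "x \<in> U" by (rule trivialisation_exists)
  note o = trivialisation(1)[OF U(1)]
  obtain \<rho> K where \<rho>: "\<rho> \<in> smooth_functions (atlas E)" "closed K" "K \<subseteq> U" "\<And>y. y \<notin> K \<Longrightarrow> \<rho> y = 0" "\<rho> x = 1"
    by (rule bump_function_exists[OF smooth_manifold_atlas o U(2)]) blast
  define q where "q u b y = (if y \<in> U then \<rho> y *\<^sub>R (\<psi> y (u y) \<bullet> b) else 0)" for u and b :: 'f and y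
  have q: "q u b \<in> smooth_functions (atlas E)" if u: "u \<in> sections E UNIV" for u b
  proof -
    have "smooth_map_on (atlas E) (UNIV \<inter> U) (\<lambda>y. \<psi> y (u y) \<bullet> b)"
      using sections_smooth[OF u U(1)] o
      by (intro smooth_map_on_inner[OF smooth_manifold_atlas] smooth_map_on_const) simp_all
    then have "smooth_map_on (atlas E) UNIV (\<lambda>y. if y \<in> U then \<rho> y *\<^sub>R (\<psi> y (u y) \<bullet> b) else 0)"
      using \<rho>(1)
      by (intro smooth_map_on_extend_zero[OF smooth_manifold_atlas open_UNIV o \<rho>(2,3) _ \<rho>(4)])
        (simp_all add: smooth_functions_def)
    then show ?thesis by (simp add: smooth_functions_def q_def[abs_def])
  qed
  define i where "i = inv_into (fibre E x) (\<psi> x)"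
  define S where "S u = (\<Sum>b\<in>Basis. v (q u b) *\<^sub>R b)" for u
  define \<delta> where "\<delta> u = (if u \<in> sections E UNIV then i (S u) else 0)" for u
  note lin = trivialisation(2)[OF U(1)]
  have i_mem: "i w \<in> fibre E x" for w unfolding i_def by (rule trivialisation_inverse(2)[OF U])
  have i_inv: "i (\<psi> x e) = e" if "e \<in> fibre E x" for e
    unfolding i_def by (rule trivialisation_inverse(3)[OF U that])
  have \<psi>_i: "\<psi> x (i w) = w" for w unfolding i_def by (rule trivialisation_inverse(1)[OF U])
  have i_add: "i (w + z) = i w + i z" for w z
    using i_inv[OF subspace_add[OF subspace_fibre i_mem i_mem], of w z]
    by (simp add: linear_add[OF lin[OF U(2)]] \<psi>_i)
  have i_scale: "i (c *\<^sub>R w) = c *\<^sub>R i w" for c w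
    using i_inv[OF subspace_scale[OF subspace_fibre i_mem], of c w]
    by (simp add: linear_scale[OF lin[OF U(2)]] \<psi>_i)
  have S_add: "S (u + w) = S u + S w" if u: "u \<in> sections E UNIV" and w: "w \<in> sections E UNIV" for u w
  proof -
    have "q (u + w) b = q u b + q w b" for b
      by (rule ext) (simp add: q_def linear_add[OF lin] inner_add_left distrib_left)
    then have "v (q (u + w) b) = v (q u b) + v (q w b)" for b
      using v q[OF u] q[OF w] by (simp add: tangent_space_def)
    then show ?thesis by (simp add: S_def scaleR_add_left sum.distrib)
  qed
  have S_scale: "S (c *\<^sub>R u) = c *\<^sub>R S u" if u: "u \<in> sections E UNIV" for u c
  proof -
    have "q (c *\<^sub>R u) b = c *\<^sub>R q u b" for b
      by (rule ext) (simp add: q_def scaleR_fun_def linear_scale[OF lin])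
    then have "v (q (c *\<^sub>R u) b) = c * v (q u b)" for b
      using v q[OF u] by (simp add: tangent_space_def)
    then show ?thesis by (simp add: S_def scaleR_sum_right)
  qed
  have S_mult: "S (\<lambda>y. f y *\<^sub>R u y) = v f *\<^sub>R \<psi> x (u x) + f x *\<^sub>R S u"
    if u: "u \<in> sections E UNIV" and f: "f \<in> smooth_functions (atlas E)" for u f
  proof -
    have "q (\<lambda>y. f y *\<^sub>R u y) b = f * q u b" for b
      by (rule ext) (simp add: q_def linear_scale[OF lin])
    then have "v (q (\<lambda>y. f y *\<^sub>R u y) b) = v f * q u b x + f x * v (q u b)" for b
      using v q[OF u] f by (simp add: tangent_space_def)
    then have "S (\<lambda>y. f y *\<^sub>R u y) = (\<Sum>b\<in>Basis. (v f * q u b x + f x * v (q u b)) *\<^sub>R b)"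
      by (simp add: S_def)
    also have "\<dots> = v f *\<^sub>R (\<Sum>b\<in>Basis. (\<psi> x (u x) \<bullet> b) *\<^sub>R b) + f x *\<^sub>R S u"
      using U(2) \<rho>(5)
      by (simp add: q_def S_def scaleR_add_left sum.distrib scaleR_sum_right)
    finally show ?thesis by (simp add: euclidean_representation)
  qed
  have "has_symbol E x \<delta> v"
    unfolding has_symbol_def
  proof (intro conjI ballI v)
    fix f u assume f: "f \<in> smooth_functions (atlas E)" and u: "u \<in> sections E UNIV"
    have "u x \<in> fibre E x" using u by (simp add: sections_def)
    then show "\<delta> (\<lambda>y. f y *\<^sub>R u y) = v f *\<^sub>R u x + f x *\<^sub>R \<delta> u"
      using u sections_mult[OF f u] by (simp add: \<delta>_def S_mult[OF u f] i_add i_scale i_inv)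
  qed
  moreover from this have "\<delta> \<in> gauge_fibre E x"
    by (rule gauge_fibreI[rotated 3])
      (simp_all add: \<delta>_def i_mem S_add S_scale i_add i_scale sections_add sections_scaleR)
  ultimately show thesis using that symbol_eqI by blast
qed

end

section \<open>Forms on the gauge algebroid\<close>

text \<open>The form \<open>\<sigma>\<^sup>*\<theta> \<otimes> e\<close>. The type of \<open>e\<close> is arbitrary because \<open>e = 1\<close> gives the scalar form
\<open>\<sigma>\<^sup>*\<theta>\<close>.\<close>

definition symbol_pullback ::
  "('p::topological_space, 'm::euclidean_space, 'e::real_vector, 'f::euclidean_space) vbundle
     \<Rightarrow> 'p \<Rightarrow> ((('p \<Rightarrow> real) \<Rightarrow> real) list \<Rightarrow> real) \<Rightarrow> 'w::real_vector
     \<Rightarrow> (('p \<Rightarrow> 'e) \<Rightarrow> 'e) list \<Rightarrow> 'w" where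
  "symbol_pullback E x \<theta> e =
     (\<lambda>\<delta>s. if set \<delta>s \<subseteq> gauge_fibre E x then \<theta> (map (symbol E x) \<delta>s) *\<^sub>R e else 0)"

text \<open>The form \<open>du \<and> \<sigma>\<^sup>*\<eta>\<close>, where \<open>du(\<delta>) = \<delta>u\<close>.\<close>

definition jet_wedge ::
  "('p::topological_space, 'm::euclidean_space, 'e::real_vector, 'f::euclidean_space) vbundle
     \<Rightarrow> 'p \<Rightarrow> ((('p \<Rightarrow> real) \<Rightarrow> real) list \<Rightarrow> real) \<Rightarrow> ('p \<Rightarrow> 'e)
     \<Rightarrow> (('p \<Rightarrow> 'e) \<Rightarrow> 'e) list \<Rightarrow> 'e" where
  "jet_wedge E x \<eta> u =
     wedge (gauge_fibre E x) (\<lambda>\<delta> c. c *\<^sub>R \<delta> u) (symbol_pullback E x \<eta> (1::real))"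

lemma zero_in_alt_maps: "subspace W \<Longrightarrow> (\<lambda>vs. 0) \<in> alt_maps k V W"
  by (rule alt_mapsI) (simp_all add: subspace_0)

context
  fixes E :: "('p::{t2_space,second_countable_topology}, 'm::euclidean_space,
      'e::real_vector, 'f::euclidean_space) vbundle"
    and x :: 'p
  assumes E: "vector_bundle E"
begin

private abbreviation "G \<equiv> gauge_fibre E x"
private abbreviation "T \<equiv> tangent_space (atlas E) x"
private abbreviation "F \<equiv> fibre E x"
private abbreviation "\<sigma> \<equiv> symbol E x"
private abbreviation "T_forms k \<equiv> alt_maps k T (UNIV :: real set)"
private abbreviation "\<I> \<equiv> endo_derivation E x id"

lemma symbol_pullback_in_alt_maps:
  assumes "\<theta> \<in> T_forms k" "subspace W" "e \<in> W"
  shows "symbol_pullback E x \<theta> e \<in> alt_maps k G W"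
  unfolding symbol_pullback_def
  using assms symbol_in_tangent_space[OF E] symbol_add[OF E] symbol_scaleR[OF E]
  by (intro alt_maps_pullback subspace_gauge_fibre[OF E])

lemma symbol_pullback_vertical:
  assumes "\<theta> \<in> T_forms k" "\<delta> \<in> set \<delta>s" "\<sigma> \<delta> = 0"
  shows "symbol_pullback E x \<theta> e \<delta>s = 0"
proof -
  have "0 \<in> set (map \<sigma> \<delta>s)" using assms(2,3) by force
  then show ?thesis using alt_maps_zero_arg[OF assms(1)] by (simp add: symbol_pullback_def)
qed

lemma symbol_pullback_in_J_fibre:
  assumes \<theta>: "\<theta> \<in> T_forms (Suc k)" and e: "e \<in> F"
  shows "symbol_pullback E x \<theta> e \<in> J_fibre E (Suc k) x"
proof -
  have "contraction (endo_derivation E x \<Phi>) (symbol_pullback E x \<theta> e) \<delta>s = \<Phi> 0"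
    if "linear \<Phi> \<and> \<Phi> ` F \<subseteq> F" for \<Phi> \<delta>s
    unfolding contraction_def
    using that endo_derivation_properties(2)[OF E, of \<Phi> x] linear_0[of \<Phi>]
      symbol_pullback_vertical[OF \<theta>, of "endo_derivation E x \<Phi>" "endo_derivation E x \<Phi> # \<delta>s" e]
    by simp
  then show ?thesis
    using symbol_pullback_in_alt_maps[OF \<theta> subspace_fibre[OF E] e]
      zero_in_alt_maps[OF subspace_fibre[OF E], of k T x]
    unfolding J_fibre_def by auto
qed

text \<open>A derivation with symbol zero contracts the factor \<open>\<sigma>\<^sup>*\<eta>\<close> to zero. For endomorphisms this is
the defining property of \<open>\<JJ>\<^sub>n E\<close>; the formula is also applied to the vertical
derivations that an isotropic graph assigns to forms.\<close>

lemma jet_wedge_vertical: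
  assumes \<eta>: "\<eta> \<in> T_forms k" and "\<delta> \<in> G" "\<sigma> \<delta> = 0" "set \<delta>s \<subseteq> G"
  shows "jet_wedge E x \<eta> u (\<delta> # \<delta>s) = \<eta> (map \<sigma> \<delta>s) *\<^sub>R \<delta> u"
proof -
  have "jet_wedge E x \<eta> u (\<delta> # \<delta>s) = symbol_pullback E x \<eta> 1 \<delta>s *\<^sub>R \<delta> u"
    unfolding jet_wedge_def
  proof (rule wedge_Cons)
    show "set (\<delta> # \<delta>s) \<subseteq> G" using assms by simp
    show "symbol_pullback E x \<eta> 1 (\<delta> # omit i \<delta>s) *\<^sub>R (\<delta>s ! i) u = 0" for i
      using symbol_pullback_vertical[OF \<eta> _ assms(3), of "\<delta> # omit i \<delta>s" "1::real"] by simp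
  qed
  with assms(4) show ?thesis by (simp add: symbol_pullback_def)
qed

lemma jet_wedge_in_alt_maps:
  assumes \<eta>: "\<eta> \<in> T_forms k" and u: "u \<in> sections E UNIV"
  shows "jet_wedge E x \<eta> u \<in> alt_maps (Suc k) G F"
  unfolding jet_wedge_def
proof (rule wedge_in_alt_maps[OF symbol_pullback_in_alt_maps[OF \<eta> subspace_UNIV UNIV_I]
      subspace_gauge_fibre[OF E] subspace_fibre[OF E]])
  show "c *\<^sub>R \<delta> u \<in> F" if "\<delta> \<in> G" for \<delta> c
    by (intro subspace_scale[OF subspace_fibre[OF E]] gauge_fibre_in_fibre[OF E] that u)
  show "linear (\<lambda>c. c *\<^sub>R \<delta> u)" for \<delta> :: "('p \<Rightarrow> 'e) \<Rightarrow> 'e"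
    by (rule linearI) (simp_all add: scaleR_add_left)
qed (simp_all add: scaleR_add_right scaleR_fun_def)

text \<open>The form \<open>\<lambda>\<close> demanded by the definition of \<open>\<JJ>\<^sub>n E\<close> is \<open>\<eta> \<otimes> u(x)\<close>.\<close>

lemma jet_wedge_in_J_fibre:
  assumes \<eta>: "\<eta> \<in> T_forms k" and u: "u \<in> sections E UNIV"
  shows "jet_wedge E x \<eta> u \<in> J_fibre E (Suc k) x"
proof -
  have ux: "u x \<in> F" using u by (simp add: sections_def)
  define \<eta>' where "\<eta>' = (\<lambda>vs. if set vs \<subseteq> T then \<eta> (map (\<lambda>v. v) vs) *\<^sub>R u x else 0)"
  have "\<eta>' \<in> alt_maps k T F"
    unfolding \<eta>'_def
    by (rule alt_maps_pullback[OF \<eta> subspace_tangent[OF E] _ _ _ subspace_fibre[OF E] ux]) simp_all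
  moreover have "contraction (endo_derivation E x \<Phi>) (jet_wedge E x \<eta> u) \<delta>s = \<Phi> (\<eta>' (map \<sigma> \<delta>s))"
    if "linear \<Phi> \<and> \<Phi> ` F \<subseteq> F" and \<delta>s: "length \<delta>s = k \<and> set \<delta>s \<subseteq> G" for \<Phi> \<delta>s
  proof -
    have \<Phi>: "linear \<Phi>" "\<Phi> ` F \<subseteq> F" using that(1) by auto
    have "set (map \<sigma> \<delta>s) \<subseteq> T" using \<delta>s symbol_in_tangent_space[OF E] by auto
    then show ?thesis
      using jet_wedge_vertical[OF \<eta> endo_derivation_properties[OF E \<Phi>], of \<delta>s u] \<delta>s u
      by (simp add: contraction_def endo_derivation_def linear_scale[OF \<Phi>(1)] \<eta>'_def)
  qed
  ultimately show ?thesis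
    using jet_wedge_in_alt_maps[OF \<eta> u] unfolding J_fibre_def diff_Suc_1 by blast
qed

lemma identity_derivation: "\<I> \<in> G" "\<sigma> \<I> = 0" "u \<in> sections E UNIV \<Longrightarrow> \<I> u = u x"
  using endo_derivation_properties[OF E linear_id, of x] by (simp_all add: endo_derivation_def)

text \<open>This computes the terms of the relation (R). The identity is inserted in second position because
isotropy occupies the first one.\<close>

lemma jet_wedge_identity:
  assumes \<eta>: "\<eta> \<in> T_forms k" and u: "u \<in> sections E UNIV" and "\<delta> \<in> G" "set \<delta>s \<subseteq> G"
  shows "jet_wedge E x \<eta> u (\<delta> # \<I> # \<delta>s) = - (\<eta> (\<sigma> \<delta> # map \<sigma> \<delta>s) *\<^sub>R u x)"
  using alt_maps_swap[OF jet_wedge_in_alt_maps[OF \<eta> u] subspace_gauge_fibre[OF E], of "[]" \<delta> \<I> \<delta>s]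
    jet_wedge_vertical[OF \<eta> identity_derivation(1,2), of "\<delta> # \<delta>s" u] assms(3,4) identity_derivation(3)[OF u]
  by simp

lemma lift_tangent_vectors:
  assumes "set vs \<subseteq> T"
  obtains \<delta>s where "set \<delta>s \<subseteq> G" "map \<sigma> \<delta>s = vs"
proof -
  have "\<exists>\<delta>s. set \<delta>s \<subseteq> G \<and> map \<sigma> \<delta>s = vs"
    using assms
  proof (induction vs)
    case Nil
    show ?case by (intro exI[of _ "[]"]) simp
  next
    case (Cons v vs)
    then obtain \<delta>s where \<delta>s: "set \<delta>s \<subseteq> G" "map \<sigma> \<delta>s = vs" by auto
    have "v \<in> T" using Cons.prems by simp
    then obtain \<delta> where "\<delta> \<in> G" "\<sigma> \<delta> = v" by (rule symbol_surjective[OF E])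
    with \<delta>s show ?case by (intro exI[of _ "\<delta> # \<delta>s"]) simp
  qed
  with that show thesis by blast
qed

lemma kernel_of_covector:
  assumes "dim_at_least (Suc k) T"
  shows "subspace {v \<in> T. v f = 0}" "dim_at_least k {v \<in> T. v f = 0}"
proof -
  show "subspace {v \<in> T. v f = 0}" using subspace_annihilator[OF subspace_tangent[OF E, of x], of "{f}"] by simp
  show "dim_at_least k {v \<in> T. v f = 0}"
    by (rule dim_at_least_kernel[OF subspace_tangent[OF E] assms]) (simp_all add: scaleR_fun_def)
qed

text \<open>The wedge product of the differentials of a triangular system that starts with \<open>v\<close>.\<close>

lemma form_detecting_vector:
  assumes d: "dim_at_least (Suc k) T" and v: "v \<in> T" "v \<noteq> 0"
  obtains \<eta> \<delta>s where "\<eta> \<in> T_forms (Suc k)" "set \<delta>s \<subseteq> G" "\<eta> (v # map \<sigma> \<delta>s) \<noteq> 0"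
proof -
  obtain f where f: "v f \<noteq> 0" using v(2) by (auto simp: fun_eq_iff)
  have "dim_at_least (k + 0) {v \<in> T. v f = 0}" using kernel_of_covector(2)[OF d] by simp
  then obtain fs vs where vs: "length vs = k" "set vs \<subseteq> {v \<in> T. v f = 0}" "triangular fs vs"
    by (rule triangular_exists[OF kernel_of_covector(1)[OF d]])
  have t: "triangular (f # fs) (v # vs)" using f vs by auto
  have T: "set (v # vs) \<subseteq> T" using v(1) vs(2) by auto
  obtain \<delta>s where \<delta>s: "set \<delta>s \<subseteq> G" "map \<sigma> \<delta>s = vs" using T by (auto intro: lift_tangent_vectors[of vs])
  show thesis
  proof (rule that)
    show "diff_wedge T (f # fs) \<in> T_forms (Suc k)"
      using diff_wedge_in_alt_maps[OF subspace_tangent[OF E], where fs = "f # fs"] triangular_length[OF t] vs(1)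
      by (simp del: diff_wedge.simps)
    show "set \<delta>s \<subseteq> G" by (rule \<delta>s(1))
    show "diff_wedge T (f # fs) (v # map \<sigma> \<delta>s) \<noteq> 0"
      unfolding \<delta>s(2) by (rule diff_wedge_triangular[OF t T])
  qed
qed

text \<open>Insertion of the identity shows that the symbol is annihilated by all forms \<open>\<eta>\<close>, hence zero.
Then the contraction is \<open>\<sigma>\<^sup>*\<eta> \<otimes> \<delta>u\<close>, and \<open>\<eta>\<close> can be taken nonzero.\<close>

lemma forms_detect_derivations:
  assumes d: "dim_at_least (Suc k) T" and \<delta>: "\<delta> \<in> G"
    and zero: "\<And>\<eta> u \<delta>s. \<eta> \<in> T_forms (Suc k) \<Longrightarrow> u \<in> sections E UNIV \<Longrightarrow> set \<delta>s \<subseteq> G \<Longrightarrow>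
      jet_wedge E x \<eta> u (\<delta> # \<delta>s) = 0"
  shows "\<delta> = 0"
proof -
  have s: "\<sigma> \<delta> = 0"
  proof (rule ccontr)
    assume "\<sigma> \<delta> \<noteq> 0"
    then obtain \<eta> \<delta>s where *: "\<eta> \<in> T_forms (Suc k)" "set \<delta>s \<subseteq> G" "\<eta> (\<sigma> \<delta> # map \<sigma> \<delta>s) \<noteq> 0"
      by (rule form_detecting_vector[OF d symbol_in_tangent_space[OF E \<delta>]])
    obtain e where e: "e \<in> F" "e \<noteq> 0" by (rule fibre_nonzero[OF E])
    obtain u where u: "u \<in> sections E UNIV" "u x = e" by (rule section_through[OF E e(1)])
    have "jet_wedge E x \<eta> u (\<delta> # \<I> # \<delta>s) = 0"
      by (rule zero[OF *(1) u(1)]) (use *(2) identity_derivation(1) in simp)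
    then show False using jet_wedge_identity[OF *(1) u(1) \<delta> *(2)] *(3) u(2) e(2) by simp
  qed
  have "dim_at_least (Suc k + 0) T" using d by simp
  then obtain fs vs where vs: "length vs = Suc k" "set vs \<subseteq> T" "triangular fs vs"
    by (rule triangular_exists[OF subspace_tangent[OF E]])
  obtain \<delta>s where \<delta>s: "set \<delta>s \<subseteq> G" "map \<sigma> \<delta>s = vs" by (rule lift_tangent_vectors[OF vs(2)])
  have \<eta>: "diff_wedge T fs \<in> T_forms (Suc k)"
    using diff_wedge_in_alt_maps[OF subspace_tangent[OF E], where fs = fs] triangular_length[OF vs(3)] vs(1) by simp
  have "\<delta> u = 0" for u
  proof (cases "u \<in> sections E UNIV")
    case True
    have "diff_wedge T fs vs *\<^sub>R \<delta> u = 0"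
      using zero[OF \<eta> True \<delta>s(1)] jet_wedge_vertical[OF \<eta> \<delta> s \<delta>s(1), of u] \<delta>s(2) by simp
    then show ?thesis using diff_wedge_triangular[OF vs(3,2)] by simp
  qed (rule gauge_fibre_outside[OF E \<delta>])
  then show ?thesis by (simp add: fun_eq_iff)
qed

text \<open>The four steps described at the beginning; the first three are \<open>symbol_of_B_pullback\<close>,
\<open>symbol_of_B_jet\<close> and \<open>B_jet\<close>.\<close>

lemma isotropic_graph_zero:
  fixes \<L> :: "('p, 'e) omni set"
  assumes n: "n = Suc (Suc k)" "n \<le> DIM('m)" "DIM('f) \<ge> 2 \<or> n < DIM('m)"
    and sub: "\<L> \<subseteq> omni_fibre E n x"
    and surj: "\<And>\<nu>. \<nu> \<in> J_fibre E n x \<Longrightarrow> \<exists>\<delta>. (\<delta>, \<nu>) \<in> \<L>"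
    and iso: "\<And>\<delta> \<mu> \<epsilon> \<nu> \<delta>s. (\<delta>, \<mu>) \<in> \<L> \<Longrightarrow> (\<epsilon>, \<nu>) \<in> \<L> \<Longrightarrow> \<nu> (\<delta> # \<delta>s) + \<mu> (\<epsilon> # \<delta>s) = 0"
    and mem: "(\<delta>, \<mu>) \<in> \<L>"
  shows "\<delta> = 0"
proof -
  have dim: "dim_at_least j T" if "j \<le> DIM('m)" for j
    using dim_at_least_mono[OF dim_at_least_tangent_space[OF smooth_manifold_atlas[OF E]] that] .
  have dk: "dim_at_least (Suc k) T" using dim n by simp
  have G: "\<delta> \<in> G" if "(\<delta>, \<mu>) \<in> \<L>" for \<delta> \<mu> using that sub by (auto simp: omni_fibre_def)
  have jet: "\<exists>\<delta>. (\<delta>, jet_wedge E x \<eta> u) \<in> \<L>"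
    if "\<eta> \<in> T_forms (Suc k)" "u \<in> sections E UNIV" for \<eta> u
    using surj jet_wedge_in_J_fibre[OF that] n(1) by simp
  obtain e where e: "e \<in> F" "e \<noteq> 0" by (rule fibre_nonzero[OF E])
  have symbol_of_B_pullback: "\<sigma> \<delta> = 0"
    if \<theta>: "\<theta> \<in> T_forms n" and \<delta>: "(\<delta>, symbol_pullback E x \<theta> e) \<in> \<L>" for \<theta> \<delta>
  proof (rule ccontr)
    assume "\<sigma> \<delta> \<noteq> 0"
    then obtain \<eta> \<delta>s where *: "\<eta> \<in> T_forms (Suc k)" "set \<delta>s \<subseteq> G" "\<eta> (\<sigma> \<delta> # map \<sigma> \<delta>s) \<noteq> 0"
      by (rule form_detecting_vector[OF dk symbol_in_tangent_space[OF E G[OF \<delta>]]])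
    obtain u where u: "u \<in> sections E UNIV" "u x = e" by (rule section_through[OF E e(1)])
    obtain \<epsilon> where \<epsilon>: "(\<epsilon>, jet_wedge E x \<eta> u) \<in> \<L>" using jet[OF *(1) u(1)] by blast
    have "symbol_pullback E x \<theta> e (\<epsilon> # \<I> # \<delta>s) = 0"
      by (rule symbol_pullback_vertical[OF \<theta> _ identity_derivation(2)]) simp
    then show False
      using iso[OF \<delta> \<epsilon>, of "\<I> # \<delta>s"] jet_wedge_identity[OF *(1) u(1) G[OF \<delta>] *(2)] *(3) u(2) e(2) by simp
  qed
  have symbol_of_B_jet: "\<sigma> \<delta> = 0"
    if \<eta>: "\<eta> \<in> T_forms (Suc k)" and u: "u \<in> sections E UNIV"
      and \<delta>: "(\<delta>, jet_wedge E x \<eta> u) \<in> \<L>" for \<eta> u \<delta>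
  proof (rule ccontr)
    assume X: "\<sigma> \<delta> \<noteq> 0"
    have ux: "u x \<in> F" using u by (simp add: sections_def)
    from n(3) show False
    proof
      \<comment> \<open>Relation (R) with \<open>u'(x)\<close> independent of \<open>u(x)\<close>.\<close>
      assume "DIM('f) \<ge> 2"
      then obtain e' where e': "e' \<in> F" "\<And>a b. a *\<^sub>R e' + b *\<^sub>R u x = 0 \<Longrightarrow> a = 0"
        using fibre_independent[OF E _ ux] by blast
      obtain w where w: "w \<in> sections E UNIV" "w x = e'" by (rule section_through[OF E e'(1)])
      obtain \<eta>' \<delta>s where *: "\<eta>' \<in> T_forms (Suc k)" "set \<delta>s \<subseteq> G" "\<eta>' (\<sigma> \<delta> # map \<sigma> \<delta>s) \<noteq> 0"
        by (rule form_detecting_vector[OF dk symbol_in_tangent_space[OF E G[OF \<delta>]] X])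
      obtain \<epsilon> where \<epsilon>: "(\<epsilon>, jet_wedge E x \<eta>' w) \<in> \<L>" using jet[OF *(1) w(1)] by blast
      have "- (\<eta>' (\<sigma> \<delta> # map \<sigma> \<delta>s)) *\<^sub>R e' + - (\<eta> (\<sigma> \<epsilon> # map \<sigma> \<delta>s)) *\<^sub>R u x = 0"
        using iso[OF \<delta> \<epsilon>, of "\<I> # \<delta>s"] jet_wedge_identity[OF *(1) w(1) G[OF \<delta>] *(2)]
          jet_wedge_identity[OF \<eta> u G[OF \<epsilon>] *(2)] w(2) by simp
      from e'(2)[OF this] *(3) show False by simp
    next
      \<comment> \<open>Now \<open>f\<close> extends a system in the kernel of \<open>f\<close>, on which moreover \<open>\<eta>\<close> vanishes, to
        one that starts with the symbol. This is where the dimension has to exceed \<open>n\<close>.\<close>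
      assume "n < DIM('m)"
      then have d: "dim_at_least (Suc (Suc (Suc k))) T" using dim n(1) by simp
      obtain f where f: "\<sigma> \<delta> f \<noteq> 0" using X by (auto simp: fun_eq_iff)
      obtain fs vs where vs: "length vs = Suc k" "set vs \<subseteq> {v \<in> T. v f = 0}" "triangular fs vs" "\<eta> vs = 0"
        by (rule triangular_in_kernel[OF kernel_of_covector(1)[OF d] kernel_of_covector(2)[OF d] _ _ \<eta>]) auto
      have t: "triangular (f # fs) (\<sigma> \<delta> # vs)" using f vs by auto
      have T: "set (\<sigma> \<delta> # vs) \<subseteq> T" using symbol_in_tangent_space[OF E G[OF \<delta>]] vs(2) by auto
      have \<theta>: "diff_wedge T (f # fs) \<in> T_forms n"
        using diff_wedge_in_alt_maps[OF subspace_tangent[OF E], where fs = "f # fs"] triangular_length[OF t] vs(1) n(1)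
        by (simp del: diff_wedge.simps)
      have "set vs \<subseteq> T" using T by simp
      then obtain \<delta>s where \<delta>s: "set \<delta>s \<subseteq> G" "map \<sigma> \<delta>s = vs" by (rule lift_tangent_vectors)
      have "symbol_pullback E x (diff_wedge T (f # fs)) e \<in> J_fibre E n x"
        using symbol_pullback_in_J_fibre[OF _ e(1)] \<theta> n(1) by simp
      then obtain \<epsilon> where \<epsilon>: "(\<epsilon>, symbol_pullback E x (diff_wedge T (f # fs)) e) \<in> \<L>" using surj by blast
      have "jet_wedge E x \<eta> u (\<epsilon> # \<delta>s) = 0"
        using jet_wedge_vertical[OF \<eta> G[OF \<epsilon>] symbol_of_B_pullback[OF \<theta> \<epsilon>] \<delta>s(1)] \<delta>s(2) vs(4) by simp
      moreover have "symbol_pullback E x (diff_wedge T (f # fs)) e (\<delta> # \<delta>s)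
          = diff_wedge T (f # fs) (\<sigma> \<delta> # vs) *\<^sub>R e"
        using G[OF \<delta>] \<delta>s by (simp add: symbol_pullback_def del: diff_wedge.simps)
      ultimately have "diff_wedge T (f # fs) (\<sigma> \<delta> # vs) *\<^sub>R e = 0" using iso[OF \<delta> \<epsilon>, of \<delta>s] by simp
      then show False using diff_wedge_triangular[OF t T] e(2) by (simp del: diff_wedge.simps)
    qed
  qed
  have B_jet: "\<delta> = 0"
    if \<eta>: "\<eta> \<in> T_forms (Suc k)" and u: "u \<in> sections E UNIV"
      and \<delta>: "(\<delta>, jet_wedge E x \<eta> u) \<in> \<L>" for \<eta> u \<delta>
  proof -
    have d: "dim_at_least (Suc (Suc k)) T" using dim n by simp
    obtain fs vs where vs: "length vs = Suc k" "set vs \<subseteq> T" "triangular fs vs" "\<eta> vs = 0"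
      by (rule triangular_in_kernel[OF subspace_tangent[OF E] d _ order_refl \<eta>]) auto
    have \<eta>': "diff_wedge T fs \<in> T_forms (Suc k)"
      using diff_wedge_in_alt_maps[OF subspace_tangent[OF E], where fs = fs] triangular_length[OF vs(3)] vs(1) by simp
    obtain \<delta>s where \<delta>s: "set \<delta>s \<subseteq> G" "map \<sigma> \<delta>s = vs" by (rule lift_tangent_vectors[OF vs(2)])
    have "\<delta> w = 0" for w
    proof (cases "w \<in> sections E UNIV")
      case True
      obtain \<epsilon> where \<epsilon>: "(\<epsilon>, jet_wedge E x (diff_wedge T fs) w) \<in> \<L>" using jet[OF \<eta>' True] by blast
      have "diff_wedge T fs vs *\<^sub>R \<delta> w = 0"
        using iso[OF \<delta> \<epsilon>, of \<delta>s] jet_wedge_vertical[OF \<eta> G[OF \<epsilon>] symbol_of_B_jet[OF \<eta>' True \<epsilon>] \<delta>s(1)]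
          jet_wedge_vertical[OF \<eta>' G[OF \<delta>] symbol_of_B_jet[OF \<eta> u \<delta>] \<delta>s(1)] \<delta>s(2) vs(4) by simp
      then show ?thesis using diff_wedge_triangular[OF vs(3,2)] by simp
    qed (rule gauge_fibre_outside[OF E G[OF \<delta>]])
    then show ?thesis by (simp add: fun_eq_iff)
  qed
  show ?thesis
  proof (rule forms_detect_derivations[OF dk G[OF mem]])
    fix \<eta> u \<delta>s
    assume *: "\<eta> \<in> T_forms (Suc k)" "u \<in> sections E UNIV" "set \<delta>s \<subseteq> G"
    obtain \<epsilon> where \<epsilon>: "(\<epsilon>, jet_wedge E x \<eta> u) \<in> \<L>" using jet[OF *(1,2)] by blast
    have "\<mu> \<in> alt_maps n G F" using mem sub by (auto simp: omni_fibre_def J_fibre_def)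
    then have "\<mu> (0 # \<delta>s) = 0" by (rule alt_maps_zero_arg) simp
    then show "jet_wedge E x \<eta> u (\<delta> # \<delta>s) = 0"
      using iso[OF mem \<epsilon>, of \<delta>s] B_jet[OF *(1,2) \<epsilon>] by simp
  qed
qed

end

section \<open>Rigidity, maximality and involutivity\<close>

lemma form_eval_zero:
  assumes "\<And>x. \<omega> x \<in> alt_maps n (V x) (W x)" and "(\<lambda>x. 0) \<in> set Ds"
  shows "form_eval \<omega> Ds = (\<lambda>x. 0)"
proof
  fix x
  have "0 \<in> set (map (\<lambda>D. D x) Ds)" using assms(2) by force
  then show "form_eval \<omega> Ds x = 0"
    unfolding form_eval_def by (rule alt_maps_zero_arg[OF assms(1)])
qed

lemma gauge_sections_zero_section:
  assumes "vector_bundle E" "D \<in> gauge_sections E UNIV"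
  shows "D x (\<lambda>y. 0) = 0"
proof -
  have "D x \<in> gauge_fibre E x" using assms(2) by (simp add: gauge_sections_def)
  from gauge_fibre_scaleR[OF assms(1) this zero_in_sections[OF assms(1)], of 0]
  show ?thesis by (simp add: scaleR_fun_def)
qed

lemma nth_in_set_nths: "i < length xs \<Longrightarrow> i \<in> I \<Longrightarrow> xs ! i \<in> set (nths xs I)"
  by (auto simp: set_nths)

text \<open>Every term of the Cartan formula either has the zero field among the arguments of the form, where
multilinearity applies, or differentiates along the zero field, or applies a derivation to the zero
section. The bracket of the zero field with a derivation is again the zero field.\<close>

lemma bracket_of_forms_zero:
  assumes E: "vector_bundle E"
    and \<omega>: "\<And>x. \<omega> x \<in> alt_maps n (gauge_fibre E x) (fibre E x)"
    and Ds: "set Ds \<subseteq> gauge_sections E UNIV"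
  shows "gauge_d (form_eval \<omega>) ((\<lambda>x. 0) # Ds) = (\<lambda>x. 0)"
    and "gauge_d (contraction (\<lambda>x. 0) (form_eval \<omega>)) Ds = (\<lambda>x. 0)"
proof -
  let ?Z = "\<lambda>x. 0 :: ('a \<Rightarrow> 'c) \<Rightarrow> 'c"
  have fe: "form_eval \<omega> Ds' = (\<lambda>x. 0)" if "?Z \<in> set Ds'" for Ds'
    by (rule form_eval_zero[OF \<omega> that])
  have D0: "D x (\<lambda>y. 0) = 0" if "D \<in> insert ?Z (set Ds)" for D x
    using that gauge_sections_zero_section[OF E, of D x] Ds by auto
  show "gauge_d (contraction ?Z (form_eval \<omega>)) Ds = (\<lambda>x. 0)"
  proof
    fix x
    have "(Ds ! i) x (\<lambda>y. 0) = 0" if "i < length Ds" for i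
      using D0[of "Ds ! i" x] nth_mem[OF that] by simp
    then show "gauge_d (contraction ?Z (form_eval \<omega>)) Ds x = 0"
      by (simp add: gauge_d_def contraction_def fe)
  qed
  show "gauge_d (form_eval \<omega>) (?Z # Ds) = (\<lambda>x. 0)"
  proof
    fix x
    let ?Ds = "?Z # Ds"
    have keep: "?Z \<in> set (nths ?Ds I)" if "0 \<in> I" for I
      using nth_in_set_nths[of 0 ?Ds I] that by simp
    have t1: "(?Ds ! i) x (form_eval \<omega> (nths ?Ds (- {i}))) = 0" if "i < length ?Ds" for i
    proof (cases "i = 0")
      case False
      then have "form_eval \<omega> (nths ?Ds (- {i})) = (\<lambda>x. 0)" by (intro fe keep) simp
      then show ?thesis using D0[of "?Ds ! i" x] nth_mem[OF that] by simp
    qed simp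
    have t2: "form_eval \<omega> (gauge_bracket (?Ds ! i) (?Ds ! j) # nths ?Ds (- {i, j})) x = 0"
      if "j < length ?Ds" "i < j" for i j
    proof (cases "i = 0")
      case True
      have "gauge_bracket (?Ds ! i) (?Ds ! j) = ?Z"
        using D0[of "?Ds ! j"] nth_mem[OF that(1)] True by (simp add: gauge_bracket_def fun_eq_iff)
      then show ?thesis using fe by simp
    next
      case False
      then have "?Z \<in> set (gauge_bracket (?Ds ! i) (?Ds ! j) # nths ?Ds (- {i, j}))"
        using that by (simp add: keep)
      then show ?thesis using fe by simp
    qed
    have "(\<Sum>i<length ?Ds. (-1) ^ i *\<^sub>R (?Ds ! i) x (form_eval \<omega> (nths ?Ds (- {i})))) = 0"
      by (intro sum.neutral ballI) (simp only: t1 lessThan_iff scaleR_zero_right)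
    moreover have "(\<Sum>j<length ?Ds. \<Sum>i<j. (-1) ^ (i + j) *\<^sub>R
        form_eval \<omega> (gauge_bracket (?Ds ! i) (?Ds ! j) # nths ?Ds (- {i, j})) x) = 0"
      by (intro sum.neutral ballI) (simp only: t2 lessThan_iff scaleR_zero_right)
    ultimately show "gauge_d (form_eval \<omega>) ?Ds x = 0"
      unfolding gauge_d_def by (simp only: add_0_left)
  qed
qed

lemma zero_in_J_sections:
  assumes E: "vector_bundle E"
  shows "(\<lambda>x vs. 0) \<in> J_sections E n UNIV"
proof -
  have "(\<lambda>vs. 0) \<in> J_fibre E n x" for x
    using zero_in_alt_maps[OF subspace_fibre[OF E], of n "gauge_fibre E x" x]
      zero_in_alt_maps[OF subspace_fibre[OF E], of "n - 1" "tangent_space (atlas E) x" x]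
    unfolding J_fibre_def
    by (auto simp: contraction_def linear_0 intro!: bexI[of _ "\<lambda>vs. 0"])
  then show ?thesis using zero_in_sections[OF E] by (simp add: J_sections_def form_eval_def)
qed

lemma zero_in_gauge_sections:
  assumes E: "vector_bundle E"
  shows "(\<lambda>x. 0) \<in> gauge_sections E UNIV"
proof -
  have "(\<lambda>x. 0) \<in> vector_fields (atlas E) UNIV"
    using subspace_0[OF subspace_tangent[OF E]] by (simp add: vector_fields_def smooth_map_on_const)
  then show ?thesis
    using subspace_0[OF subspace_gauge_fibre[OF E]] zero_in_sections[OF E] has_symbol_zero[OF E]
    unfolding gauge_sections_def by (auto intro!: bexI[of _ "\<lambda>x. 0"])
qed

lemma involutive_zero_J:
  assumes E: "vector_bundle E"
  shows "involutive E n (\<lambda>x. {0} \<times> J_fibre E n x)"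
  unfolding involutive_def
proof (intro ballI)
  let ?Z = "\<lambda>x. 0 :: ('a \<Rightarrow> 'c) \<Rightarrow> 'c"
  fix e1 e2
  assume e: "e1 \<in> sub_sections E n (\<lambda>x. {0} \<times> J_fibre E n x) UNIV"
    "e2 \<in> sub_sections E n (\<lambda>x. {0} \<times> J_fibre E n x) UNIV"
  have fst: "fst \<circ> e1 = ?Z" "fst \<circ> e2 = ?Z"
    using e by (auto simp: sub_sections_def fun_eq_iff mem_Times_iff)
  have alt: "(snd \<circ> e1) x \<in> alt_maps n (gauge_fibre E x) (fibre E x)"
    "(snd \<circ> e2) x \<in> alt_maps n (gauge_fibre E x) (fibre E x)" for x
    using e by (auto simp: sub_sections_def mem_Times_iff J_fibre_def)
  let ?e = "\<lambda>x. (0, \<lambda>vs. 0) :: ('a, 'c) omni"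
  have J: "(\<lambda>x vs. 0) \<in> J_sections E n UNIV" by (rule zero_in_J_sections[OF E])
  then have "?e \<in> sub_sections E n (\<lambda>x. {0} \<times> J_fibre E n x) UNIV"
    using zero_in_gauge_sections[OF E]
    by (simp add: sub_sections_def omni_sections_def comp_def J_sections_def)
  moreover have "fst \<circ> ?e = fst (omni_bracket e1 e2)"
    by (simp add: omni_bracket_def fst gauge_bracket_def fun_eq_iff)
  moreover have "form_eval (snd \<circ> ?e) Ds = snd (omni_bracket e1 e2) Ds"
    if "set Ds \<subseteq> gauge_sections E UNIV" for Ds
  proof -
    have "snd (omni_bracket e1 e2) Ds = (\<lambda>x. 0)"
      using bracket_of_forms_zero[where \<omega> = "snd \<circ> e1", OF E alt(1) that]
        bracket_of_forms_zero[where \<omega> = "snd \<circ> e2", OF E alt(2) that]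
      by (intro ext) (simp add: omni_bracket_def gauge_lie_def fst contraction_def)
    then show ?thesis by (simp add: form_eval_def)
  qed
  ultimately show "\<exists>e\<in>sub_sections E n (\<lambda>x. {0} \<times> J_fibre E n x) UNIV.
      fst \<circ> e = fst (omni_bracket e1 e2) \<and>
      (\<forall>Ds. length Ds = n \<and> set Ds \<subseteq> gauge_sections E UNIV \<longrightarrow>
        form_eval (snd \<circ> e) Ds = snd (omni_bracket e1 e2) Ds)"
    by (intro bexI[of _ ?e]) auto
qed

lemma pairing_zeroD:
  assumes "pairing (\<delta>, \<mu>) (\<epsilon>, \<nu>) = 0"
  shows "\<nu> (\<delta> # \<delta>s) + \<mu> (\<epsilon> # \<delta>s) = 0"
  using fun_cong[OF assms, of \<delta>s] by (simp add: pairing_def contraction_def scaleR_fun_def)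

theorem theorem3p6:
  fixes E :: "('p::{t2_space,second_countable_topology}, 'm::euclidean_space,
      'e::real_vector, 'f::euclidean_space) vbundle"
    and n :: nat
    and L :: "'p \<Rightarrow> ('p, 'e) omni set"
  assumes "vector_bundle E"
    and "1 < n" and "n < DIM('m) + 1"
    and "\<not> (DIM('f) = 1 \<and> n = DIM('m))"
    and "subbundle E n L" and "isotropic L" and "projects_isomorphically E n L"
  shows "L = (\<lambda>x. {0} \<times> J_fibre E n x) \<and> higher_dirac_jacobi E n L"
proof -
  note E = assms(1)
  define k where "k = n - 2"
  have n: "n = Suc (Suc k)" "n \<le> DIM('m)" using assms(2,3) by (auto simp: k_def)
  have r: "DIM('f) \<ge> 2 \<or> n < DIM('m)" using assms(3,4) DIM_positive[where 'a = 'f] by linarith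
  have sub: "L' x \<subseteq> omni_fibre E n x" if "subbundle E n L'" for L' x
    using that unfolding subbundle_def by blast
  have iso: "\<nu> (\<delta> # \<delta>s) + \<mu> (\<epsilon> # \<delta>s) = 0"
    if "isotropic L'" "(\<delta>, \<mu>) \<in> L' x" "(\<epsilon>, \<nu>) \<in> L' x" for L' :: "'p \<Rightarrow> ('p, 'e) omni set" and x \<delta> \<mu> \<epsilon> \<nu> \<delta>s
    using that pairing_zeroD unfolding isotropic_def by blast
  have bij: "snd ` L x = J_fibre E n x" for x
    using assms(7) by (auto simp: projects_isomorphically_def bij_betw_def)
  have "\<delta> = 0" if "(\<delta>, \<mu>) \<in> L x" for x \<delta> \<mu>
  proof (rule isotropic_graph_zero[where \<L> = "L x" and x = x, OF E n r sub[OF assms(5)] _ _ that])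
    show "\<nu> (\<delta> # \<delta>s) + \<mu> (\<epsilon> # \<delta>s) = 0" if "(\<delta>, \<mu>) \<in> L x" "(\<epsilon>, \<nu>) \<in> L x" for \<delta> \<mu> \<epsilon> \<nu> \<delta>s
      by (rule iso[OF assms(6) that])
    show "\<exists>\<delta>. (\<delta>, \<nu>) \<in> L x" if "\<nu> \<in> J_fibre E n x" for \<nu>
      using that bij[of x] by force
  qed
  then have "L x = {0} \<times> J_fibre E n x" for x
    using bij[of x] by force
  then have L: "L = (\<lambda>x. {0} \<times> J_fibre E n x)" by (rule ext)
  have "L' = L" if L': "subbundle E n L'" "isotropic L'" "\<forall>x. L x \<subseteq> L' x" for L'
  proof (rule ext)
    fix x
    have "dim_at_least DIM('m) (tangent_space (atlas E) x)"
      by (rule dim_at_least_tangent_space[OF smooth_manifold_atlas[OF E]])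
    then have dim: "dim_at_least (Suc k) (tangent_space (atlas E) x)"
      by (rule dim_at_least_mono) (use n in simp)
    have "\<delta> = 0" if mem: "(\<delta>, \<mu>) \<in> L' x" for \<delta> \<mu>
    proof (rule forms_detect_derivations[OF E dim])
      show "\<delta> \<in> gauge_fibre E x" using mem sub[OF L'(1)] by (auto simp: omni_fibre_def)
      fix \<eta> u \<delta>s
      assume "\<eta> \<in> alt_maps (Suc k) (tangent_space (atlas E) x) (UNIV :: real set)" "u \<in> sections E UNIV"
      then have "jet_wedge E x \<eta> u \<in> J_fibre E n x" unfolding n(1) by (rule jet_wedge_in_J_fibre[OF E])
      then have "(0, jet_wedge E x \<eta> u) \<in> L x" by (simp add: L)
      then have "(0, jet_wedge E x \<eta> u) \<in> L' x" using L'(3) by blast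
      moreover have "\<mu> \<in> alt_maps n (gauge_fibre E x) (fibre E x)"
        using mem sub[OF L'(1)] by (auto simp: omni_fibre_def J_fibre_def)
      then have "\<mu> (0 # \<delta>s) = 0" by (rule alt_maps_zero_arg) simp
      ultimately show "jet_wedge E x \<eta> u (\<delta> # \<delta>s) = 0" using iso[OF L'(2) mem, of 0 _ \<delta>s] by simp
    qed
    then have "L' x \<subseteq> L x" using sub[OF L'(1), of x] by (auto simp: L omni_fibre_def)
    with L'(3) show "L' x = L x" by blast
  qed
  then have "maximal_isotropic E n L" using assms(5,6) by (auto simp: maximal_isotropic_def)
  then show ?thesis using L involutive_zero_J[OF E] by (simp add: higher_dirac_jacobi_def)
qed

end
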